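(* Consider the full-information maintenance Markov decision process with machine set $\mathcal{M}=\{1,\ldots,M\}$ defined in the context, and let $Q(\cdot,\cdot)$ denote the state-action value function of an optimal policy. Let $x=(x_1,\lambda_1,\phi_1,\ldots,x_M,\lambda_M,\phi_M)$ be a state, let $a^*(x)\in\mathcal{U}(x)$ be an optimal action in state $x$, i.e. $a^*(x)\in\arg\min_{a\in\mathcal{U}(x)}Q(x,a)$, and let $\mathcal{M}(x)=\{m\in\mathcal{M} : a^*_m(x)=1\}$ be the set of machines maintained under this optimal action. Let $y=(y_1,\lambda_1,\phi_1,\ldots,y_M,\lambda_M,\phi_M)$ be any state with the same degradation parameters as $x$ such that 1. $y_m\ge x_m$ for all $m\in\mathcal{M}(x)$, and 2. $y_m=x_m$ for all $m\in\mathcal{M}\setminus\mathcal{M}(x)$. Then $$a^*(x)\in\arg\min_{a\in\mathcal{U}(y)}Q(y,a),$$ that is, the optimal action $a^*(x)$ for state $x$ is also an optimal action for state $y$.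
   Context: **Model.** There are $M$ machines, $\mathcal{M}=\{1,\ldots,M\}$. Machine $m$ has a failure threshold $\xi_m>0$, a preventive replacement cost $c_m^{\mathrm{PM}}$ and a corrective replacement cost $c_m^{\mathrm{CM}}$ with $0<c_m^{\mathrm{PM}}<c_m^{\mathrm{CM}}<\infty$. There is a shared setup cost $c^{\mathrm{ST}}\ge 0$ and a discount factor $\gamma\in[0,1)$. For each $m$, $\Lambda_m$ and $\Phi_m$ are given (known) probability distributions on, respectively, the set $\mathbb{R}_+$ of shock rates and the set of shock-size parameters. *Degradation.* While its parameters are $(\lambda_m,\phi_m)$, machine $m$ accumulates damage according to a compound Poisson process: shocks arrive by a Poisson process of rate $\lambda_m$, and the shock sizes are i.i.d. non-negative random variables, independent of the arrivals, with density or mass function from a one-parameter exponential family with linear sufficient statistic, $f_m(x\mid\phi_m)=h_m(x)e^{\phi_m x-A_m(\phi_m)}$, where $h_m$ and $A_m$ are known functions. Machines degrade independently of each other. *States.* A state is a vector $h=(x_1,\lambda_1,\phi_1,\ldots,x_M,\lambda_M,\phi_M)$, where $x_m\ge 0$ is the degradation level of machine $m$ and $\lambda_m,\phi_m$ are its current (observed) degradation parameters. Machine $m$ is failed if $x_m\ge\xi_m$. *Actions.* At each decision epoch $t=0,1,2,\ldots$ an action $a=(a_1,\ldots,a_M)\in\mathcal{U}(h)=\mathcal{U}_1(h)\times\cdots\times\mathcal{U}_M(h)$ is chosen, where $\mathcal{U}_m(h)=\{0,1\}$ if $x_m<\xi_m$ and $\mathcal{U}_m(h)=\{1\}$ if $x_m\ge\xi_m$;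 $a_m=1$ means that machine $m$ is maintained (replaced). *Costs.* $$C(h,a)=c^{\mathrm{ST}}\mathbf{1}_{\{\sum_{m}a_m>0\}}+\sum_{m\in\mathcal{M}}\left(c_m^{\mathrm{CM}}\mathbf{1}_{\{a_m=1,\,x_m\ge\xi_m\}}+c_m^{\mathrm{PM}}\mathbf{1}_{\{a_m=1,\,x_m<\xi_m\}}\right).$$ *Transitions.* Given $h$ and $a$: for every $m$ with $a_m=1$, instantaneously the degradation level is reset to $0$ and new parameters $\lambda_m,\phi_m$ are drawn independently from $\Lambda_m$ and $\Phi_m$; for every $m$ with $a_m=0$ the level and parameters are unchanged. Then each machine, independently, accumulates one time unit of compound Poisson damage with its current parameters, which is added to its level; the parameters stay fixed. The resulting random state is denoted $\hat{h}(a)$. *Values.* $V(h)$ is the minimum over all policies of the total expected discounted cost $\mathbb{E}\big[\sum_{t=0}^\infty\gamma^t C(h(t),a(t))\mid h(0)=h\big]$, and $Q(h,a)=C(h,a)+\gamma\,\mathbb{E}[V(\hat{h}(a))]$ for $a\in\mathcal{U}(h)$, so that $V(h)=\min_{a\in\mathcal{U}(h)}Q(h,a)$. *)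

theory Defs
  imports "HOL-Probability.Probability"
begin

text \<open>
  The machines are the elements of a finite type \<open>'m\<close>. The state of a single machine is a triple
  (level, shock rate, shock-size parameter); \<open>a m = True\<close> means that machine \<open>m\<close> is maintained.
\<close>

type_synonym machine_state = "real \<times> real \<times> real"
type_synonym 'm state = "'m \<Rightarrow> machine_state"
type_synonym 'm action = "'m \<Rightarrow> bool"

abbreviation level :: "machine_state \<Rightarrow> real" where "level s \<equiv> fst s"
abbreviation shock_rate :: "machine_state \<Rightarrow> real" where "shock_rate s \<equiv> fst (snd s)"
abbreviation shock_param :: "machine_state \<Rightarrow> real" where "shock_param s \<equiv> snd (snd s)"

abbreviation nonneg_borel :: "real measure" where
  "nonneg_borel \<equiv> restrict_space borel {0..}"

text \<open>
  The shock sizes of machine \<open>m\<close> with parameter \<open>\<phi>\<close> have the density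
  \<open>x \<mapsto> base_fun m x * exp (\<phi> * x - log_partition m \<phi>)\<close> with respect to \<open>ref_measure m\<close>, which is
  Lebesgue measure on the nonnegative reals (densities) or counting measure on a countable set of
  nonnegative reals (mass functions).
\<close>

record 'm maintenance_model =
  threshold :: "'m \<Rightarrow> real"
  pm_cost :: "'m \<Rightarrow> real"
  cm_cost :: "'m \<Rightarrow> real"
  setup_cost :: real
  discount :: real
  rate_dist :: "'m \<Rightarrow> real measure"
  param_set :: "'m \<Rightarrow> real set"
  param_dist :: "'m \<Rightarrow> real measure"
  ref_measure :: "'m \<Rightarrow> real measure"
  base_fun :: "'m \<Rightarrow> real \<Rightarrow> real"
  log_partition :: "'m \<Rightarrow> real \<Rightarrow> real"

definition shock_density :: "'m maintenance_model \<Rightarrow> 'm \<Rightarrow> real \<Rightarrow> real \<Rightarrow> real" where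
  "shock_density P m \<phi> x = base_fun P m x * exp (\<phi> * x - log_partition P m \<phi>)"

definition shock_size :: "'m maintenance_model \<Rightarrow> 'm \<Rightarrow> real \<Rightarrow> real measure" where
  "shock_size P m \<phi> = density (ref_measure P m) (\<lambda>x. ennreal (shock_density P m \<phi> x))"

locale maintenance_mdp =
  fixes P :: "'m::finite maintenance_model"
  assumes threshold_pos: "\<And>m. 0 < threshold P m"
    and pm_cost_pos: "\<And>m. 0 < pm_cost P m"
    and pm_less_cm: "\<And>m. pm_cost P m < cm_cost P m"
    and setup_cost_nonneg: "0 \<le> setup_cost P"
    and discount_nonneg: "0 \<le> discount P"
    and discount_less_1: "discount P < 1"
    and prob_rate_dist: "\<And>m. prob_space (rate_dist P m)"
    and sets_rate_dist: "\<And>m. sets (rate_dist P m) = sets nonneg_borel"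
    and prob_param_dist: "\<And>m. prob_space (param_dist P m)"
    and sets_param_dist: "\<And>m. sets (param_dist P m) = sets (restrict_space borel (param_set P m))"
    and ref_measure: "\<And>m. ref_measure P m = restrict_space lborel {0..} \<or>
          (\<exists>S. countable S \<and> S \<subseteq> {0..} \<and>
               ref_measure P m = distr (count_space S) nonneg_borel (\<lambda>x. x))"
    and base_fun_measurable: "\<And>m. base_fun P m \<in> borel_measurable nonneg_borel"
    and base_fun_nonneg: "\<And>m x. 0 \<le> x \<Longrightarrow> 0 \<le> base_fun P m x"
    and prob_shock_size: "\<And>m \<phi>. \<phi> \<in> param_set P m \<Longrightarrow> prob_space (shock_size P m \<phi>)"

definition machine_space :: "'m maintenance_model \<Rightarrow> 'm \<Rightarrow> machine_state measure" where
  "machine_space P m =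
     nonneg_borel \<Otimes>\<^sub>M (nonneg_borel \<Otimes>\<^sub>M restrict_space borel (param_set P m))"

definition state_space :: "'m maintenance_model \<Rightarrow> 'm state measure" where
  "state_space P = PiM UNIV (machine_space P)"

definition failed :: "'m maintenance_model \<Rightarrow> 'm state \<Rightarrow> 'm \<Rightarrow> bool" where
  "failed P h m \<longleftrightarrow> threshold P m \<le> level (h m)"

definition admissible :: "'m maintenance_model \<Rightarrow> 'm state \<Rightarrow> 'm action set" where
  "admissible P h = {a. \<forall>m. failed P h m \<longrightarrow> a m}"

definition stage_cost :: "'m::finite maintenance_model \<Rightarrow> 'm state \<Rightarrow> 'm action \<Rightarrow> real" where
  "stage_cost P h a =
     setup_cost P * of_bool (\<exists>m. a m) +
     (\<Sum>m\<in>UNIV. cm_cost P m * of_bool (a m \<and> failed P h m)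
              + pm_cost P m * of_bool (a m \<and> \<not> failed P h m))"

text \<open>
  The number of shocks in one time unit; \<open>poisson_pmf\<close> is only specified for positive rates.
\<close>
definition shock_count :: "real \<Rightarrow> nat pmf" where
  "shock_count l = (if l = 0 then return_pmf 0 else poisson_pmf l)"

text \<open>The distribution of the compound Poisson damage accumulated in one time unit.\<close>
definition damage :: "'m maintenance_model \<Rightarrow> 'm \<Rightarrow> real \<Rightarrow> real \<Rightarrow> real measure" where
  "damage P m l \<phi> =
     measure_pmf (shock_count l) \<bind>
       (\<lambda>n. distr (PiM {..<n} (\<lambda>_. shock_size P m \<phi>)) nonneg_borel (\<lambda>z. \<Sum>i<n. z i))"

definition degrade :: "'m maintenance_model \<Rightarrow> 'm \<Rightarrow> machine_state \<Rightarrow> machine_state measure" where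
  "degrade P m s =
     distr (damage P m (shock_rate s) (shock_param s)) (machine_space P m)
       (\<lambda>z. (level s + z, shock_rate s, shock_param s))"

definition machine_transition ::
    "'m maintenance_model \<Rightarrow> 'm \<Rightarrow> machine_state \<Rightarrow> bool \<Rightarrow> machine_state measure" where
  "machine_transition P m s maintained =
     (if maintained
      then (rate_dist P m \<Otimes>\<^sub>M param_dist P m) \<bind> (\<lambda>(l, \<phi>). degrade P m (0, l, \<phi>))
      else degrade P m s)"

definition transition ::
    "'m maintenance_model \<Rightarrow> 'm state \<Rightarrow> 'm action \<Rightarrow> 'm state measure" where
  "transition P h a = PiM UNIV (\<lambda>m. machine_transition P m (h m) (a m))"

text \<open>
  Policies are randomized and history-dependent: given the state-action pairs at the epochs before
  \<open>t\<close> and the current state, \<open>\<pi> t\<close> returns the distribution of the action at epoch \<open>t\<close>.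
\<close>

definition step_space :: "'m maintenance_model \<Rightarrow> ('m state \<times> 'm action) measure" where
  "step_space P = state_space P \<Otimes>\<^sub>M count_space UNIV"

type_synonym 'm policy =
  "nat \<Rightarrow> (nat \<Rightarrow> 'm state \<times> 'm action) \<times> 'm state \<Rightarrow> 'm action measure"

definition policies :: "'m maintenance_model \<Rightarrow> 'm policy set" where
  "policies P = {\<pi>. \<forall>t.
     \<pi> t \<in> (PiM {0..<t} (\<lambda>_. step_space P) \<Otimes>\<^sub>M state_space P) \<rightarrow>\<^sub>M prob_algebra (count_space UNIV) \<and>
     (\<forall>w \<in> space (PiM {0..<t} (\<lambda>_. step_space P)). \<forall>h \<in> space (state_space P).
        AE a in \<pi> t (w, h). a \<in> admissible P h)}"

definition state_kernel ::
    "'m maintenance_model \<Rightarrow> 'm state \<Rightarrow> nat \<Rightarrow> (nat \<Rightarrow> 'm state \<times> 'm action) \<Rightarrow> 'm state measure" where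
  "state_kernel P h0 t w =
     (case t of 0 \<Rightarrow> return (state_space P) h0
              | Suc s \<Rightarrow> transition P (fst (w s)) (snd (w s)))"

definition step_kernel ::
    "'m maintenance_model \<Rightarrow> 'm policy \<Rightarrow> 'm state \<Rightarrow> nat \<Rightarrow> (nat \<Rightarrow> 'm state \<times> 'm action) \<Rightarrow>
     ('m state \<times> 'm action) measure" where
  "step_kernel P \<pi> h0 t w =
     state_kernel P h0 t w \<bind> (\<lambda>h. \<pi> t (w, h) \<bind> (\<lambda>a. return (step_space P) (h, a)))"

text \<open>
  The law of the whole state-action process under policy \<open>\<pi>\<close> started in \<open>h0\<close>, that is, the measure that
  the Ionescu-Tulcea theorem yields for the conditional laws \<open>step_kernel P \<pi> h0 t\<close> of the pair at
  epoch \<open>t\<close> given the pairs before \<open>t\<close>.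
\<close>
definition trajectory ::
    "'m maintenance_model \<Rightarrow> 'm policy \<Rightarrow> 'm state \<Rightarrow> (nat \<Rightarrow> 'm state \<times> 'm action) measure" where
  "trajectory P \<pi> h0 =
     projective_family.lim UNIV
       (Ionescu_Tulcea.CI (step_kernel P \<pi> h0) (\<lambda>_. step_space P)) (\<lambda>_. step_space P)"

definition policy_cost :: "'m::finite maintenance_model \<Rightarrow> 'm policy \<Rightarrow> 'm state \<Rightarrow> real" where
  "policy_cost P \<pi> h =
     (LINT w|trajectory P \<pi> h. (\<Sum>t. discount P ^ t * stage_cost P (fst (w t)) (snd (w t))))"

definition V :: "'m::finite maintenance_model \<Rightarrow> 'm state \<Rightarrow> real" where
  "V P h = (INF \<pi>\<in>policies P. policy_cost P \<pi> h)"

definition Q :: "'m::finite maintenance_model \<Rightarrow> 'm state \<Rightarrow> 'm action \<Rightarrow> real" where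
  "Q P h a = stage_cost P h a + discount P * (LINT h'|transition P h a. V P h')"

definition optimal_action :: "'m::finite maintenance_model \<Rightarrow> 'm state \<Rightarrow> 'm action \<Rightarrow> bool" where
  "optimal_action P h a \<longleftrightarrow> is_arg_min (Q P h) (\<lambda>b. b \<in> admissible P h) a"

end

theory Submission
  imports Defs
begin

text \<open>
  A machine that is failed in \<open>y\<close> but not in \<open>x\<close> is maintained by \<open>a\<close> and by every action that is
  admissible in \<open>y\<close>, so passing from \<open>x\<close> to \<open>y\<close> raises all stage costs in question by the same
  amount. The transition under \<open>a\<close> does not change, while under any other action the successor of \<open>y\<close>
  is the successor of \<open>x\<close> with some levels shifted upwards. It remains to see that \<open>V\<close> is measurable
  and increasing in the levels. Both properties pass to the limit of value iteration, and this limit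
  is \<open>V\<close>: telescoping the Bellman inequality along a trajectory bounds the cost of every policy from
  below, with equality for the policy that is greedy for the limit.
\<close>

subsection \<open>Measurability of the transition kernel\<close>

text \<open>\<open>V\<close> is an infimum over randomized, history-dependent policies, so neither
  its measurability nor its monotonicity can be read off. Measurability matters already for the
  meaning of \<open>Q\<close>: a Bochner integral of a nonmeasurable function takes the default
  value 0. Comparing \<open>V\<close> at two states directly would require carrying a policy from
  one trajectory to the other. Value iteration avoids this, because monotonicity then only has to
  survive one transition at a time, where two states with equal parameters can be coupled by
  shifting levels.

  The iteration runs in \<open>ennreal\<close> and starts at 0. Its iterates increase, so monotone
  convergence takes the place of a contraction argument and no integrability conditions arise. Since
  stage costs are bounded and the discount factor is below 1, all values are finite and the return
  to real numbers loses nothing.\<close>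

text \<open>Boxes form an intersection-stable generator of the product space, and on a box the
  product measure is a finite product of functions measurable in the parameter.\<close>

lemma measurable_PiM_prob_algebra:
  assumes I: "finite I"
    and K: "\<And>i. i \<in> I \<Longrightarrow> K i \<in> M \<rightarrow>\<^sub>M prob_algebra (N i)"
  shows "(\<lambda>x. PiM I (\<lambda>i. K i x)) \<in> M \<rightarrow>\<^sub>M prob_algebra (PiM I N)"
proof (rule measurable_prob_algebra_generated[OF sets_PiM Int_stable_prod_algebra
        prod_algebra_sets_into_space])
  have K': "prob_space (K i x)" "sets (K i x) = sets (N i)" if "i \<in> I" "x \<in> space M" for i x
    using measurable_space[OF K[OF that(1)] that(2)] by (auto simp: space_prob_algebra)
  show "prob_space (PiM I (\<lambda>i. K i x))" if "x \<in> space M" for x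
    using K' that by (intro prob_space_PiM)
  show "sets (PiM I (\<lambda>i. K i x)) = sets (PiM I N)" if "x \<in> space M" for x
    using K' that by (intro sets_PiM_cong) auto
  fix A assume "A \<in> prod_algebra I N"
  then obtain E where A: "A = Pi\<^sub>E I E" and E: "E \<in> (\<Pi> i\<in>I. sets (N i))"
    by (rule prod_algebraE_all)
  have "emeasure (PiM I (\<lambda>i. K i x)) A = (\<Prod>i\<in>I. emeasure (K i x) (E i))" if x: "x \<in> space M" for x
  proof -
    have "emeasure (PiM I (\<lambda>i. K i x)) (prod_emb I (\<lambda>i. K i x) I (Pi\<^sub>E I E)) =
        (\<Prod>i\<in>I. emeasure (K i x) (E i))"
      using K' x E I by (intro emeasure_PiM_emb) auto
    moreover have "prod_emb I (\<lambda>i. K i x) I (Pi\<^sub>E I E) = A"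
      unfolding A using K' x E
      by (intro prod_emb_PiE_same_index) (metis Pi_mem sets.sets_into_space)
    ultimately show ?thesis by simp
  qed
  moreover have "(\<lambda>x. \<Prod>i\<in>I. emeasure (K i x) (E i)) \<in> borel_measurable M"
    using E K[THEN measurable_prob_algebraD]
    by (intro borel_measurable_prod_ennreal) (auto intro: measurable_emeasure_kernel)
  ultimately show "(\<lambda>x. emeasure (PiM I (\<lambda>i. K i x)) A) \<in> borel_measurable M"
    by (simp cong: measurable_cong)
qed

text \<open>The preimage of a box under a coordinatewise map is again a box, so both measures agree
  on boxes. The maps and spaces may vary with the coordinate, as the machines require.\<close>

lemma distr_PiM_prob_spaces:
  assumes I: "finite I"
    and N: "\<And>i. i \<in> I \<Longrightarrow> prob_space (N i)"
    and t: "\<And>i. i \<in> I \<Longrightarrow> t i \<in> N i \<rightarrow>\<^sub>M M i"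
  shows "distr (PiM I N) (PiM I M) (\<lambda>x. \<lambda>i\<in>I. t i (x i)) = PiM I (\<lambda>i. distr (N i) (M i) (t i))"
proof (rule measure_eqI_PiM_finite[OF I])
  have T: "(\<lambda>x. \<lambda>i\<in>I. t i (x i)) \<in> PiM I N \<rightarrow>\<^sub>M PiM I M"
    by (intro measurable_restrict measurable_PiM_component_rev t)
  have Nt: "prob_space (distr (N i) (M i) (t i))" if "i \<in> I" for i
    using N[OF that] t[OF that] by (rule prob_space.prob_space_distr)
  show "sets (distr (PiM I N) (PiM I M) (\<lambda>x. \<lambda>i\<in>I. t i (x i))) = sets (PiM I (\<lambda>i. distr (N i) (M i) (t i)))"
    by (auto intro!: sets_PiM_cong)
  show "sets (PiM I (\<lambda>i. distr (N i) (M i) (t i))) = sets (PiM I (\<lambda>i. distr (N i) (M i) (t i)))" ..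
  fix A assume A: "\<And>i. i \<in> I \<Longrightarrow> A i \<in> sets (distr (N i) (M i) (t i))"
  have "(\<lambda>x. \<lambda>i\<in>I. t i (x i)) -` Pi\<^sub>E I A \<inter> space (PiM I N)
      = prod_emb I N I (\<Pi>\<^sub>E i\<in>I. t i -` A i \<inter> space (N i))"
    by (auto simp: space_PiM PiE_iff prod_emb_def extensional_def restrict_def)
  moreover have "Pi\<^sub>E I A \<in> sets (PiM I M)"
    using A I by (intro sets_PiM_I_finite) auto
  ultimately have "emeasure (distr (PiM I N) (PiM I M) (\<lambda>x. \<lambda>i\<in>I. t i (x i))) (Pi\<^sub>E I A)
      = emeasure (PiM I N) (prod_emb I N I (\<Pi>\<^sub>E i\<in>I. t i -` A i \<inter> space (N i)))"
    by (simp add: emeasure_distr[OF T])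
  also have "\<dots> = (\<Prod>i\<in>I. emeasure (N i) (t i -` A i \<inter> space (N i)))"
    using A t by (intro emeasure_PiM_emb N I order_refl measurable_sets) auto
  also have "\<dots> = (\<Prod>i\<in>I. emeasure (distr (N i) (M i) (t i)) (A i))"
    using A t by (intro prod.cong) (auto simp: emeasure_distr)
  also have "\<dots> = emeasure (PiM I (\<lambda>i. distr (N i) (M i) (t i)))
      (prod_emb I (\<lambda>i. distr (N i) (M i) (t i)) I (Pi\<^sub>E I A))"
    by (rule emeasure_PiM_emb[symmetric, OF Nt order_refl I A])
  also have "prod_emb I (\<lambda>i. distr (N i) (M i) (t i)) I (Pi\<^sub>E I A) = Pi\<^sub>E I A"
    by (rule prod_emb_PiE_same_index) (use A sets.sets_into_space in blast)
  finally show "emeasure (distr (PiM I N) (PiM I M) (\<lambda>x. \<lambda>i\<in>I. t i (x i))) (Pi\<^sub>E I A)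
      = emeasure (PiM I (\<lambda>i. distr (N i) (M i) (t i))) (Pi\<^sub>E I A)" .
next
  interpret prob_space "PiM I N" using N by (rule prob_space_PiM)
  have T: "(\<lambda>x. \<lambda>i\<in>I. t i (x i)) \<in> PiM I N \<rightarrow>\<^sub>M PiM I M"
    by (intro measurable_restrict measurable_PiM_component_rev t)
  interpret D: prob_space "distr (PiM I N) (PiM I M) (\<lambda>x. \<lambda>i\<in>I. t i (x i))"
    by (rule prob_space_distr[OF T])
  let ?M = "\<lambda>i. distr (N i) (M i) (t i)"
  \<comment> \<open>Uniqueness asks for a countable cover by boxes of finite measure; the whole
    space, repeated, serves because the measure is a probability.\<close>
  show "range (\<lambda>_::nat. space (PiM I ?M)) \<subseteq> prod_algebra I ?M"
    using I by (auto simp: space_PiM intro!: prod_algebraI_finite)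
  show "(\<Union>i::nat. space (PiM I ?M)) = space (PiM I ?M)" by simp
  show "emeasure (distr (PiM I N) (PiM I M) (\<lambda>x. \<lambda>i\<in>I. t i (x i))) (space (PiM I ?M)) \<noteq> \<infinity>" for i :: nat
    by simp
qed

text \<open>Joint measurability reduces to the sections because the second component is countable.
  It is used both for shock counts and for actions.\<close>

lemma measurable_pair_count_space:
  fixes f :: "'a \<Rightarrow> 'i::countable \<Rightarrow> 'b"
  assumes "\<And>i. (\<lambda>x. f x i) \<in> M \<rightarrow>\<^sub>M N"
  shows "(\<lambda>(x, i). f x i) \<in> M \<Otimes>\<^sub>M count_space UNIV \<rightarrow>\<^sub>M N"
  unfolding split_beta'
  by (rule measurable_compose_countable[where f = "\<lambda>i q. f (fst q) i" and g = snd])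
    (auto intro: measurable_compose[OF measurable_fst assms])

lemma ennreal_eq_inverse:
  fixes a b :: ennreal
  assumes "a * b = 1"
  shows "a = inverse b"
proof -
  have "b \<noteq> 0" using assms by auto
  moreover have "b \<noteq> top" using assms by (auto simp: ennreal_mult_top split: if_splits)
  ultimately have "b * inverse b = 1"
    using ennreal_divide_self[of b] by (simp add: divide_ennreal_def less_top)
  then show ?thesis
    using assms by (metis mult.assoc mult.commute mult.left_neutral)
qed

lemma measurable_into_nonneg_borel:
  assumes "f \<in> borel_measurable M" "\<And>x. x \<in> space M \<Longrightarrow> 0 \<le> f x"
  shows "f \<in> M \<rightarrow>\<^sub>M nonneg_borel"
  using assms by (intro measurable_restrict_space2) auto

section \<open>Shock counts, damage and transitions as measurable kernels\<close>

lemma shock_count_measurable: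
  "(\<lambda>l. measure_pmf (shock_count l)) \<in> nonneg_borel \<rightarrow>\<^sub>M prob_algebra (count_space UNIV)"
proof (rule measurable_prob_algebraI)
  show "prob_space (measure_pmf (shock_count l))" for l
    by (rule prob_space_measure_pmf)
  \<comment> \<open>The Poisson formula also covers rate 0, since \<open>0 ^ 0 = 1\<close>; hence
    the case distinction in \<open>shock_count\<close> does not break measurability.\<close>
  have pmf: "pmf (shock_count l) n = l ^ n / fact n * exp (- l)" if "l \<in> space nonneg_borel" for l n
    using that by (cases "l = 0") (auto simp: shock_count_def space_restrict_space power_0_left)
  show "(\<lambda>l. measure_pmf (shock_count l)) \<in> nonneg_borel \<rightarrow>\<^sub>M subprob_algebra (count_space UNIV)"
  proof (rule measurable_subprob_algebra)
    fix A :: "nat set"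
    have "emeasure (measure_pmf (shock_count l)) A = (\<Sum>n. ennreal (pmf (shock_count l) n) * indicator A n)" for l
      by (simp add: nn_integral_measure_pmf[symmetric] nn_integral_count_space_nat[symmetric])
    moreover have "(\<lambda>l. \<Sum>n. ennreal (pmf (shock_count l) n) * indicator A n) \<in> borel_measurable nonneg_borel"
    proof -
      have "(\<lambda>l. \<Sum>n. ennreal (l ^ n / fact n * exp (- l)) * indicator A n) \<in> borel_measurable nonneg_borel"
        by (rule measurable_restrict_space1) measurable
      then show ?thesis
        by (subst measurable_cong[OF suminf_cong]) (auto simp: pmf)
    qed
    ultimately show "(\<lambda>l. emeasure (measure_pmf (shock_count l)) A) \<in> borel_measurable nonneg_borel"
      by simp
  qed (auto intro: prob_space_imp_subprob_space prob_space_measure_pmf)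
qed

context maintenance_mdp
begin

lemma sets_ref_measure [measurable_cong]: "sets (ref_measure P m) = sets nonneg_borel"
  using ref_measure[of m] by (auto simp: sets_restrict_space)

lemma space_ref_measure: "space (ref_measure P m) = {0..}"
  using sets_eq_imp_space_eq[OF sets_ref_measure[of m]] by (simp add: space_restrict_space)

text \<open>Sigma-finiteness makes integrals over the reference measure measurable in a parameter.
  In the discrete case the atoms in \<open>S\<close> have mass one and the complement of
  \<open>S\<close> is null.\<close>

lemma sigma_finite_ref_measure: "sigma_finite_measure (ref_measure P m)"
  using ref_measure[of m]
proof (elim disjE exE conjE)
  assume "ref_measure P m = restrict_space lborel {0..}"
  then show ?thesis
    by (simp add: sigma_finite_measure_restrict_space[OF sigma_finite_lborel])
next
  fix S :: "real set" assume S: "countable S" "S \<subseteq> {0..}"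
    and eq: "ref_measure P m = distr (count_space S) nonneg_borel (\<lambda>x. x)"
  have id: "(\<lambda>x. x) \<in> count_space S \<rightarrow>\<^sub>M nonneg_borel"
    using S by (auto simp: space_restrict_space)
  have sing: "{s} \<in> sets nonneg_borel" if "s \<in> S" for s
    using S that by (auto simp: sets_restrict_space)
  have "S \<in> sets nonneg_borel"
    using S sing sets.countable_UN'[of S "\<lambda>s. {s}" nonneg_borel] by auto
  then have compl: "{0..} - S \<in> sets nonneg_borel"
    by (metis sets.compl_sets space_restrict_space Int_UNIV_right space_borel)
  show ?thesis
  proof
    let ?A = "insert ({0..} - S) ((\<lambda>s. {s}) ` S)"
    have "emeasure (ref_measure P m) {s} \<noteq> \<infinity>" if "s \<in> S" for s
      using that sing[OF that] by (simp add: eq emeasure_distr[OF id] emeasure_count_space)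
    moreover have "emeasure (ref_measure P m) ({0..} - S) = 0"
      using compl by (simp add: eq emeasure_distr[OF id] Int_commute[of _ S])
    ultimately have "countable ?A \<and> ?A \<subseteq> sets (ref_measure P m) \<and> \<Union> ?A = space (ref_measure P m) \<and>
        (\<forall>a\<in>?A. emeasure (ref_measure P m) a \<noteq> \<infinity>)"
      using S sing compl by (auto simp: sets_ref_measure space_ref_measure)
    then show "\<exists>A. countable A \<and> A \<subseteq> sets (ref_measure P m) \<and> \<Union> A = space (ref_measure P m) \<and>
        (\<forall>a\<in>A. emeasure (ref_measure P m) a \<noteq> \<infinity>)" by blast
  qed
qed

text \<open>
  The function \<open>log_partition\<close> is not assumed to be measurable; since the density integrates to 1,
  \<open>exp (- log_partition P m \<phi>)\<close> is the inverse of a parameter integral.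
\<close>
lemma shock_size_measurable:
  "shock_size P m \<in> restrict_space borel (param_set P m) \<rightarrow>\<^sub>M prob_algebra nonneg_borel"
proof (rule measurable_prob_algebraI)
  let ?R = "restrict_space borel (param_set P m) :: real measure"
  interpret R: sigma_finite_measure "ref_measure P m" by (rule sigma_finite_ref_measure)
  have [measurable]: "base_fun P m \<in> borel_measurable (ref_measure P m)"
    using base_fun_measurable[of m] measurable_cong_sets[OF sets_ref_measure[of m] refl] by blast
  have idR [measurable]: "(\<lambda>\<phi>. \<phi>) \<in> borel_measurable ?R"
    by (rule measurable_restrict_space1) simp
  have idN [measurable]: "(\<lambda>x. x) \<in> borel_measurable (ref_measure P m)"
    by (subst measurable_cong_sets[OF sets_ref_measure refl]) (rule measurable_restrict_space1, simp)
  show prob: "prob_space (shock_size P m \<phi>)" if "\<phi> \<in> space ?R" for \<phi>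
    using that by (intro prob_shock_size) (simp add: space_restrict_space)
  define F where "F A \<phi> = (\<integral>\<^sup>+x. ennreal (base_fun P m x * exp (\<phi> * x)) * indicator A x \<partial>ref_measure P m)"
    for A \<phi>
  have F [measurable]: "F A \<in> borel_measurable ?R" if A: "A \<in> sets nonneg_borel" for A
  proof -
    have [measurable]: "A \<in> sets (ref_measure P m)" using A by (simp add: sets_ref_measure)
    show ?thesis unfolding F_def by measurable
  qed
  have F_eq: "emeasure (shock_size P m \<phi>) A = ennreal (exp (- log_partition P m \<phi>)) * F A \<phi>"
    if A: "A \<in> sets nonneg_borel" for A \<phi>
  proof -
    have [measurable]: "A \<in> sets (ref_measure P m)" using A by (simp add: sets_ref_measure)
    have "emeasure (shock_size P m \<phi>) A
        = (\<integral>\<^sup>+x. ennreal (shock_density P m \<phi> x) * indicator A x \<partial>ref_measure P m)"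
      unfolding shock_size_def shock_density_def by (subst emeasure_density) auto
    also have "\<dots> = (\<integral>\<^sup>+x. ennreal (exp (- log_partition P m \<phi>)) *
        (ennreal (base_fun P m x * exp (\<phi> * x)) * indicator A x) \<partial>ref_measure P m)"
    proof (rule nn_integral_cong)
      fix x assume "x \<in> space (ref_measure P m)"
      then have "0 \<le> base_fun P m x" by (intro base_fun_nonneg) (simp add: space_ref_measure)
      moreover have "shock_density P m \<phi> x = exp (- log_partition P m \<phi>) * (base_fun P m x * exp (\<phi> * x))"
        by (simp add: shock_density_def exp_diff exp_minus divide_inverse mult_ac)
      ultimately show "ennreal (shock_density P m \<phi> x) * indicator A x =
          ennreal (exp (- log_partition P m \<phi>)) * (ennreal (base_fun P m x * exp (\<phi> * x)) * indicator A x)"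
        by (simp only: ennreal_mult exp_ge_zero mult_nonneg_nonneg mult.assoc)
    qed
    finally show ?thesis by (simp add: F_def nn_integral_cmult)
  qed
  have space: "space (shock_size P m \<phi>) = {0..}" for \<phi>
    by (simp add: shock_size_def space_ref_measure)
  have sets: "sets (shock_size P m \<phi>) = sets nonneg_borel" for \<phi>
    by (simp add: shock_size_def sets_ref_measure)
  have top: "{0..} \<in> sets nonneg_borel"
    using sets.top[of nonneg_borel] by (simp add: space_restrict_space)
  have norm: "ennreal (exp (- log_partition P m \<phi>)) = inverse (F {0..} \<phi>)" if "\<phi> \<in> space ?R" for \<phi>
  proof -
    have "ennreal (exp (- log_partition P m \<phi>)) * F {0..} \<phi> = 1"
      using prob_space.emeasure_space_1[OF prob[OF that]] by (simp add: F_eq[OF top] space)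
    then show ?thesis by (rule ennreal_eq_inverse)
  qed
  show "shock_size P m \<in> ?R \<rightarrow>\<^sub>M subprob_algebra nonneg_borel"
  proof (rule measurable_subprob_algebra)
    show "subprob_space (shock_size P m \<phi>)" if "\<phi> \<in> space ?R" for \<phi>
      using prob[OF that] by (rule prob_space_imp_subprob_space)
    fix A :: "real set" assume A: "A \<in> sets nonneg_borel"
    have "(\<lambda>\<phi>. inverse (F {0..} \<phi>) * F A \<phi>) \<in> borel_measurable ?R"
      using A top by measurable
    then show "(\<lambda>\<phi>. emeasure (shock_size P m \<phi>) A) \<in> borel_measurable ?R"
      by (rule measurable_cong[THEN iffD1, rotated]) (simp add: F_eq[OF A] norm)
  qed (rule sets)
qed

text \<open>The damage is a mixture over a countable shock count. For a fixed count it is the image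
  of a product kernel under summation, so only measurability of the shock-size kernel is
  used.\<close>

lemma damage_measurable:
  "(\<lambda>(l, \<phi>). damage P m l \<phi>)
     \<in> nonneg_borel \<Otimes>\<^sub>M restrict_space borel (param_set P m) \<rightarrow>\<^sub>M prob_algebra nonneg_borel"
proof -
  let ?R = "restrict_space borel (param_set P m) :: real measure"
  let ?N = "nonneg_borel \<Otimes>\<^sub>M ?R"
  have total: "(\<lambda>z. \<Sum>i<n. z i) \<in> PiM {..<n} (\<lambda>_. nonneg_borel) \<rightarrow>\<^sub>M nonneg_borel" for n :: nat
  proof (rule measurable_into_nonneg_borel)
    show "(\<lambda>z. \<Sum>i<n. z i) \<in> borel_measurable (PiM {..<n} (\<lambda>_. nonneg_borel))"
    proof (rule borel_measurable_sum)
      fix i assume "i \<in> {..<n}"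
      then show "(\<lambda>z. z i) \<in> borel_measurable (PiM {..<n} (\<lambda>_. nonneg_borel))"
        by (intro measurable_compose[OF measurable_component_singleton]) (auto intro: measurable_restrict_space1)
    qed
  qed (auto simp: space_PiM space_restrict_space intro!: sum_nonneg)
  have fixed_count: "(\<lambda>\<phi>. distr (PiM {..<n} (\<lambda>_. shock_size P m \<phi>)) nonneg_borel (\<lambda>z. \<Sum>i<n. z i))
      \<in> ?R \<rightarrow>\<^sub>M prob_algebra nonneg_borel" for n :: nat
    by (rule measurable_compose[OF measurable_PiM_prob_algebra measurable_distr_prob_space[OF total]])
      (auto intro: shock_size_measurable)
  have "(\<lambda>p. measure_pmf (shock_count (fst p)) \<bind>
      (\<lambda>n. distr (PiM {..<n} (\<lambda>_. shock_size P m (snd p))) nonneg_borel (\<lambda>z. \<Sum>i<n. z i)))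
      \<in> ?N \<rightarrow>\<^sub>M prob_algebra nonneg_borel"
  proof (rule measurable_bind_prob_space2)
    show "(\<lambda>p. measure_pmf (shock_count (fst p))) \<in> ?N \<rightarrow>\<^sub>M prob_algebra (count_space UNIV)"
      by (rule measurable_compose[OF measurable_fst shock_count_measurable])
    show "(\<lambda>(p, n::nat). distr (PiM {..<n} (\<lambda>_. shock_size P m (snd p))) nonneg_borel (\<lambda>z. \<Sum>i<n. z i))
        \<in> ?N \<Otimes>\<^sub>M count_space UNIV \<rightarrow>\<^sub>M prob_algebra nonneg_borel"
      by (intro measurable_pair_count_space measurable_compose[OF measurable_snd fixed_count])
  qed
  then show ?thesis
    by (simp add: damage_def split_beta')
qed

lemma degrade_measurable: "degrade P m \<in> machine_space P m \<rightarrow>\<^sub>M prob_algebra (machine_space P m)"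
proof -
  let ?R = "restrict_space borel (param_set P m) :: real measure"
  have sp: "machine_space P m = nonneg_borel \<Otimes>\<^sub>M (nonneg_borel \<Otimes>\<^sub>M ?R)"
    by (simp add: machine_space_def)
  have add: "(\<lambda>p. fst (fst p) + snd p) \<in> machine_space P m \<Otimes>\<^sub>M nonneg_borel \<rightarrow>\<^sub>M nonneg_borel"
  proof (rule measurable_into_nonneg_borel)
    have "(\<lambda>p. fst (fst p)) \<in> borel_measurable (machine_space P m \<Otimes>\<^sub>M nonneg_borel)"
      unfolding sp by (rule measurable_compose[OF measurable_compose[OF measurable_fst measurable_fst]])
        (rule measurable_restrict_space1, simp)
    moreover have "snd \<in> borel_measurable (machine_space P m \<Otimes>\<^sub>M nonneg_borel)"
      by (rule measurable_compose[OF measurable_snd, of "\<lambda>x. x", simplified])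
        (rule measurable_restrict_space1, simp)
    ultimately show "(\<lambda>p. fst (fst p) + snd p) \<in> borel_measurable (machine_space P m \<Otimes>\<^sub>M nonneg_borel)"
      by (rule borel_measurable_add)
  qed (auto simp: sp space_pair_measure space_restrict_space)
  have params: "(\<lambda>p. snd (fst p)) \<in> machine_space P m \<Otimes>\<^sub>M nonneg_borel \<rightarrow>\<^sub>M nonneg_borel \<Otimes>\<^sub>M ?R"
    unfolding sp by (rule measurable_compose[OF measurable_fst measurable_snd])
  show ?thesis
    unfolding degrade_def[abs_def]
  proof (rule measurable_distr_prob_space2)
    show "(\<lambda>s. damage P m (shock_rate s) (shock_param s)) \<in> machine_space P m \<rightarrow>\<^sub>M prob_algebra nonneg_borel"
      unfolding sp using measurable_compose[OF measurable_snd damage_measurable[of m]]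
      by (simp add: split_beta')
    show "(\<lambda>(s, z). (level s + z, shock_rate s, shock_param s))
        \<in> machine_space P m \<Otimes>\<^sub>M nonneg_borel \<rightarrow>\<^sub>M machine_space P m"
      using measurable_Pair[OF add params] by (simp add: split_beta' flip: sp)
  qed
qed

lemma machine_transition_measurable:
  "(\<lambda>s. machine_transition P m s b) \<in> machine_space P m \<rightarrow>\<^sub>M prob_algebra (machine_space P m)"
proof (cases b)
  case False
  then show ?thesis using degrade_measurable[of m] by (simp add: machine_transition_def)
next
  case True
  let ?R = "restrict_space borel (param_set P m) :: real measure"
  have "(\<lambda>p. (0, p)) \<in> nonneg_borel \<Otimes>\<^sub>M ?R \<rightarrow>\<^sub>M machine_space P m"
    unfolding machine_space_def by (rule measurable_Pair) (auto simp: space_restrict_space)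
  then have kernel: "(\<lambda>(l, \<phi>). degrade P m (0, l, \<phi>)) \<in> nonneg_borel \<Otimes>\<^sub>M ?R \<rightarrow>\<^sub>M prob_algebra (machine_space P m)"
    using measurable_compose[OF _ degrade_measurable[of m]] by (simp add: split_beta')
  have "sets (rate_dist P m \<Otimes>\<^sub>M param_dist P m) = sets (nonneg_borel \<Otimes>\<^sub>M ?R)"
    by (rule sets_pair_measure_cong[OF sets_rate_dist sets_param_dist])
  then have init: "rate_dist P m \<Otimes>\<^sub>M param_dist P m \<in> space (prob_algebra (nonneg_borel \<Otimes>\<^sub>M ?R))"
    using prob_space_pair[OF prob_rate_dist prob_param_dist] by (simp add: space_prob_algebra)
  show ?thesis
    using True measurable_bind_prob_space[OF measurable_const[OF init] kernel]
    by (simp add: machine_transition_def)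
qed

lemma transition_measurable:
  "(\<lambda>h. transition P h a) \<in> state_space P \<rightarrow>\<^sub>M prob_algebra (state_space P)"
  unfolding transition_def state_space_def
proof (rule measurable_PiM_prob_algebra)
  fix m
  show "(\<lambda>h. machine_transition P m (h m) (a m))
      \<in> PiM UNIV (machine_space P) \<rightarrow>\<^sub>M prob_algebra (machine_space P m)"
    by (rule measurable_compose[where g = "\<lambda>s. machine_transition P m s (a m)"])
      (auto intro: machine_transition_measurable)
qed simp

subsection \<open>Value iteration and monotonicity in the levels\<close>

lemma machine_in_space: "h \<in> space (state_space P) \<Longrightarrow> h m \<in> space (machine_space P m)"
  by (auto simp: state_space_def space_PiM)

lemma
  assumes "h \<in> space (state_space P)"
  shows prob_space_transition: "prob_space (transition P h a)"
    and sets_transition: "sets (transition P h a) = sets (state_space P)"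
  using measurable_space[OF transition_measurable assms] by (auto simp: space_prob_algebra)

lemma space_transition: "h \<in> space (state_space P) \<Longrightarrow> space (transition P h a) = space (state_space P)"
  by (rule sets_eq_imp_space_eq[OF sets_transition])

lemma machine_level_measurable: "level \<in> borel_measurable (machine_space P m)"
  unfolding machine_space_def
  by (rule measurable_compose[OF measurable_fst, of "\<lambda>x. x", simplified])
    (rule measurable_restrict_space1, simp)

lemma level_measurable [measurable]: "(\<lambda>h. level (h m)) \<in> borel_measurable (state_space P)"
  unfolding state_space_def
  by (rule measurable_PiM_component_rev[where f = level]) (simp_all add: machine_level_measurable)

lemma failed_measurable [measurable]: "Measurable.pred (state_space P) (\<lambda>h. failed P h m)"
  unfolding failed_def by measurable

lemma admissible_measurable [measurable]: "Measurable.pred (state_space P) (\<lambda>h. a \<in> admissible P h)"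
  unfolding admissible_def by simp

lemma stage_cost_measurable [measurable]: "(\<lambda>h. stage_cost P h a) \<in> borel_measurable (state_space P)"
  unfolding stage_cost_def of_bool_def by measurable

lemma top_admissible: "(\<lambda>_. True) \<in> admissible P h"
  by (simp add: admissible_def)

lemma stage_cost_nonneg: "0 \<le> stage_cost P h a"
  unfolding stage_cost_def using setup_cost_nonneg pm_cost_pos pm_less_cm
  by (intro add_nonneg_nonneg mult_nonneg_nonneg sum_nonneg) (auto intro: less_imp_le less_trans)

text \<open>The price of one setup and a corrective replacement of every machine. It dominates all
  stage costs because preventive replacement is cheaper.\<close>

definition cost_bound :: real where
  "cost_bound = setup_cost P + (\<Sum>m\<in>UNIV. cm_cost P m)"

lemma stage_cost_le: "stage_cost P h a \<le> cost_bound"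
  unfolding stage_cost_def cost_bound_def
proof (intro add_mono sum_mono)
  fix m
  show "cm_cost P m * of_bool (a m \<and> failed P h m) + pm_cost P m * of_bool (a m \<and> \<not> failed P h m) \<le> cm_cost P m"
    using pm_cost_pos[of m] pm_less_cm[of m] by auto
qed (use setup_cost_nonneg in auto)

lemma cost_bound_nonneg: "0 \<le> cost_bound"
  using stage_cost_nonneg stage_cost_le order_trans by blast

definition bellman_cost :: "('m state \<Rightarrow> ennreal) \<Rightarrow> 'm state \<Rightarrow> 'm action \<Rightarrow> ennreal" where
  "bellman_cost W h a =
     ennreal (stage_cost P h a) + ennreal (discount P) * (\<integral>\<^sup>+h'. W h' \<partial>transition P h a)"

definition bellman :: "('m state \<Rightarrow> ennreal) \<Rightarrow> 'm state \<Rightarrow> ennreal" where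
  "bellman W h = (INF a\<in>admissible P h. bellman_cost W h a)"

lemma nn_integral_transition_measurable [measurable]:
  assumes "W \<in> borel_measurable (state_space P)"
  shows "(\<lambda>h. \<integral>\<^sup>+h'. W h' \<partial>transition P h a) \<in> borel_measurable (state_space P)"
  by (rule measurable_compose[OF measurable_prob_algebraD[OF transition_measurable]
        nn_integral_measurable_subprob_algebra[OF assms]])

lemma bellman_cost_measurable [measurable]:
  assumes [measurable]: "W \<in> borel_measurable (state_space P)"
  shows "(\<lambda>h. bellman_cost W h a) \<in> borel_measurable (state_space P)"
  unfolding bellman_cost_def by measurable

lemma bellman_measurable:
  assumes [measurable]: "W \<in> borel_measurable (state_space P)"
  shows "bellman W \<in> borel_measurable (state_space P)"
proof -
  \<comment> \<open>The set of admissible actions varies with the state. Charging \<open>top\<close>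
    for the others turns the minimum into an infimum over a fixed countable set, which preserves
    measurability.\<close>
  have "bellman W = (\<lambda>h. INF a. if a \<in> admissible P h then bellman_cost W h a else top)"
  proof (intro ext antisym)
    fix h
    show "(INF a. if a \<in> admissible P h then bellman_cost W h a else top) \<le> bellman W h"
      unfolding bellman_def
    proof (rule INF_greatest)
      fix a assume "a \<in> admissible P h"
      then show "(INF a. if a \<in> admissible P h then bellman_cost W h a else top) \<le> bellman_cost W h a"
        by (intro INF_lower2[of a]) auto
    qed
    show "bellman W h \<le> (INF a. if a \<in> admissible P h then bellman_cost W h a else top)"
      unfolding bellman_def
    proof (rule INF_greatest)
      fix a
      show "(INF a\<in>admissible P h. bellman_cost W h a)
          \<le> (if a \<in> admissible P h then bellman_cost W h a else top)"
        by (cases "a \<in> admissible P h") (simp_all add: INF_lower)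
    qed
  qed
  moreover have "(\<lambda>h. INF a. if a \<in> admissible P h then bellman_cost W h a else top)
      \<in> borel_measurable (state_space P)"
    by (intro borel_measurable_INF) measurable
  ultimately show ?thesis by simp
qed

lemma bellman_cost_mono:
  assumes "h \<in> space (state_space P)" "\<And>h'. h' \<in> space (state_space P) \<Longrightarrow> W h' \<le> W' h'"
  shows "bellman_cost W h a \<le> bellman_cost W' h a"
  unfolding bellman_cost_def using assms
  by (intro add_left_mono mult_left_mono nn_integral_mono) (auto simp: space_transition)

definition value_iter :: "nat \<Rightarrow> 'm state \<Rightarrow> ennreal" where
  "value_iter n = (bellman ^^ n) (\<lambda>_. 0)"

lemma value_iter_simps: "value_iter 0 h = 0" "value_iter (Suc n) h = bellman (value_iter n) h"
  by (simp_all add: value_iter_def)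

lemma value_iter_measurable [measurable]: "value_iter n \<in> borel_measurable (state_space P)"
  by (induction n) (auto simp: value_iter_def intro: bellman_measurable)

text \<open>The iteration starts at the least function and \<open>bellman\<close> is
  monotone.\<close>

lemma value_iter_Suc_mono:
  "h \<in> space (state_space P) \<Longrightarrow> value_iter n h \<le> value_iter (Suc n) h"
proof (induction n arbitrary: h)
  case (Suc n)
  then show ?case
    unfolding value_iter_simps(2) bellman_def
    by (intro INF_mono') (rule bellman_cost_mono)
qed (simp add: value_iter_simps)

lemma value_iter_mono:
  "h \<in> space (state_space P) \<Longrightarrow> m \<le> n \<Longrightarrow> value_iter m h \<le> value_iter n h"
  by (rule lift_Suc_mono_le[of "\<lambda>n. value_iter n h"]) (auto intro: value_iter_Suc_mono)

definition opt_value :: "'m state \<Rightarrow> ennreal" where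
  "opt_value h = (SUP n. value_iter n h)"

lemma opt_value_measurable [measurable]: "opt_value \<in> borel_measurable (state_space P)"
proof -
  have "(\<lambda>h. SUP n. value_iter n h) \<in> borel_measurable (state_space P)"
    by (intro borel_measurable_SUP) auto
  then show ?thesis by (simp add: opt_value_def[abs_def])
qed

text \<open>This half of the Bellman equation holds for each iterate separately: replacing the
  continuation by its supremum can only increase the cost. The other half needs an action that stays
  optimal in the limit.\<close>

lemma opt_value_le_bellman_cost:
  assumes "h \<in> space (state_space P)" "a \<in> admissible P h"
  shows "opt_value h \<le> bellman_cost opt_value h a"
  unfolding opt_value_def[of h]
proof (rule SUP_least)
  fix n
  show "value_iter n h \<le> bellman_cost opt_value h a"
  proof (cases n)
    case (Suc k)
    have "value_iter n h \<le> bellman_cost (value_iter k) h a"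
      unfolding Suc value_iter_simps bellman_def using assms(2) by (rule INF_lower)
    also have "\<dots> \<le> bellman_cost opt_value h a"
      using assms(1) by (intro bellman_cost_mono) (auto simp: opt_value_def intro: SUP_upper)
    finally show ?thesis .
  qed (simp add: value_iter_simps)
qed

text \<open>
  Finitely many actions: one of them attains the minimum in infinitely many iterations, and it
  remains optimal in the limit by monotone convergence.
\<close>
lemma ex_greedy_action:
  assumes h: "h \<in> space (state_space P)"
  shows "\<exists>a\<in>admissible P h. bellman_cost opt_value h a \<le> opt_value h"
proof -
  have "\<exists>a\<in>admissible P h. bellman_cost (value_iter n) h a \<le> value_iter (Suc n) h" for n
  proof -
    let ?A = "bellman_cost (value_iter n) h ` admissible P h"
    have "finite ?A" "?A \<noteq> {}" using top_admissible[of h] by auto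
    then have "Inf ?A \<in> ?A" by (metis Min_in cInf_eq_Min)
    then show ?thesis by (auto simp: value_iter_simps bellman_def)
  qed
  then have "\<forall>n\<in>UNIV. \<exists>a\<in>admissible P h. bellman_cost (value_iter n) h a \<le> value_iter (Suc n) h"
    by blast
  from pigeonhole_infinite_rel[OF infinite_UNIV_nat _ this]
  obtain a where a: "a \<in> admissible P h"
    and inf: "infinite {n. bellman_cost (value_iter n) h a \<le> value_iter (Suc n) h}"
    by auto
  have le: "bellman_cost (value_iter k) h a \<le> opt_value h" for k
  proof -
    obtain n where n: "k \<le> n" "bellman_cost (value_iter n) h a \<le> value_iter (Suc n) h"
      using inf by (auto simp: infinite_nat_iff_unbounded_le)
    have "bellman_cost (value_iter k) h a \<le> bellman_cost (value_iter n) h a"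
      using h n(1) by (intro bellman_cost_mono value_iter_mono)
    also have "\<dots> \<le> opt_value h"
      using n(2) SUP_upper[of "Suc n" UNIV "\<lambda>n. value_iter n h"] unfolding opt_value_def
      by (meson UNIV_I order_trans)
    finally show ?thesis .
  qed
  have "(\<integral>\<^sup>+h'. opt_value h' \<partial>transition P h a) = (SUP n. \<integral>\<^sup>+h'. value_iter n h' \<partial>transition P h a)"
    unfolding opt_value_def
  proof (rule nn_integral_monotone_convergence_SUP_AE)
    show "value_iter n \<in> borel_measurable (transition P h a)" for n
      using value_iter_measurable measurable_cong_sets[OF sets_transition[OF h] refl] by blast
    show "AE h' in transition P h a. value_iter n h' \<le> value_iter (Suc n) h'" for n
      by (rule AE_I2) (simp add: space_transition[OF h] value_iter_Suc_mono)
  qed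
  then have "bellman_cost opt_value h a = (SUP n. bellman_cost (value_iter n) h a)"
    unfolding bellman_cost_def by (simp add: SUP_mult_left_ennreal ennreal_SUP_add_right)
  also have "\<dots> \<le> opt_value h" using le by (rule SUP_least)
  finally show ?thesis using a by blast
qed

text \<open>Maintaining every machine is admissible in every state. The bound \<open>?B\<close>
  solves \<open>cost_bound + discount P * ?B = ?B\<close>, so using this one action shows that the
  bound reproduces itself under \<open>bellman\<close>.\<close>

lemma opt_value_le:
  assumes "h \<in> space (state_space P)"
  shows "opt_value h \<le> ennreal (cost_bound / (1 - discount P))"
  unfolding opt_value_def
proof (rule SUP_least)
  let ?B = "cost_bound / (1 - discount P)"
  have B: "0 \<le> ?B" "cost_bound + discount P * ?B = ?B"
    using cost_bound_nonneg discount_less_1 by (auto simp: field_simps)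
  fix n
  show "value_iter n h \<le> ennreal ?B"
    using assms
  proof (induction n arbitrary: h)
    case (Suc n)
    interpret prob_space "transition P h (\<lambda>_. True)" by (rule prob_space_transition[OF Suc.prems])
    have "(\<integral>\<^sup>+h'. value_iter n h' \<partial>transition P h (\<lambda>_. True)) \<le> (\<integral>\<^sup>+h'. ennreal ?B \<partial>transition P h (\<lambda>_. True))"
      by (intro nn_integral_mono Suc.IH) (simp add: space_transition[OF Suc.prems])
    then have "(\<integral>\<^sup>+h'. value_iter n h' \<partial>transition P h (\<lambda>_. True)) \<le> ennreal ?B"
      by (simp add: emeasure_space_1)
    then have "bellman_cost (value_iter n) h (\<lambda>_. True) \<le> ennreal cost_bound + ennreal (discount P) * ennreal ?B"
      unfolding bellman_cost_def by (intro add_mono mult_left_mono ennreal_leI stage_cost_le) auto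
    also have "\<dots> = ennreal ?B"
      using B discount_nonneg cost_bound_nonneg by (metis ennreal_mult ennreal_plus mult_nonneg_nonneg)
    finally show ?case
      unfolding value_iter_simps bellman_def using INF_lower2[OF top_admissible] by blast
  qed (simp add: value_iter_simps)
qed

section \<open>Coupling of transitions from comparable states\<close>

definition less_worn :: "'m state \<Rightarrow> 'm state \<Rightarrow> bool" where
  "less_worn x y \<longleftrightarrow> (\<forall>m. level (x m) \<le> level (y m) \<and> snd (x m) = snd (y m))"

text \<open>The damage law depends on the parameters only, and \<open>less_worn\<close> makes them
  equal. Both states can therefore suffer the same damage, and an unmaintained machine keeps its
  initial gap. A maintained machine forgets its old state, so \<open>T\<close> leaves it
  alone.\<close>

lemma transition_shift:
  fixes x y :: "'m state" and a :: "'m action"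
  assumes x: "x \<in> space (state_space P)" and y: "y \<in> space (state_space P)" and le: "less_worn x y"
  defines "T \<equiv> \<lambda>h m. if a m then h m else (level (h m) + (level (y m) - level (x m)), snd (h m))"
  shows "transition P y a = distr (transition P x a) (state_space P) T"
    and "T \<in> state_space P \<rightarrow>\<^sub>M state_space P"
proof -
  define t where "t m s = (if a m then s else (level s + (level (y m) - level (x m)), snd s))"
    for m and s :: machine_state
  have T: "T h = (\<lambda>m\<in>UNIV. t m (h m))" for h
    by (auto simp: T_def t_def)
  have K: "prob_space (machine_transition P m (h m) (a m))"
      "sets (machine_transition P m (h m) (a m)) = sets (machine_space P m)"
    if "h \<in> space (state_space P)" for m h
    using measurable_space[OF machine_transition_measurable machine_in_space[OF that, of m]]
    by (auto simp: space_prob_algebra)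
  have shift: "(\<lambda>s. (level s + (level (y m) - level (x m)), snd s)) \<in> machine_space P m \<rightarrow>\<^sub>M machine_space P m" for m
  proof -
    have "level (x m) \<le> level (y m)" using le by (simp add: less_worn_def)
    then have "(\<lambda>s. level s + (level (y m) - level (x m))) \<in> machine_space P m \<rightarrow>\<^sub>M nonneg_borel"
      by (intro measurable_into_nonneg_borel borel_measurable_add machine_level_measurable)
        (auto simp: machine_space_def space_pair_measure space_restrict_space)
    moreover have "snd \<in> machine_space P m \<rightarrow>\<^sub>M nonneg_borel \<Otimes>\<^sub>M restrict_space borel (param_set P m)"
      by (simp add: machine_space_def)
    ultimately show ?thesis
      using measurable_Pair by (fastforce simp: machine_space_def)
  qed
  have t_meas: "t m \<in> machine_space P m \<rightarrow>\<^sub>M machine_space P m" for m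
    using shift[of m] by (cases "a m") (simp_all add: t_def[abs_def])
  show "T \<in> state_space P \<rightarrow>\<^sub>M state_space P"
    unfolding T[abs_def] state_space_def
    by (intro measurable_restrict measurable_PiM_component_rev t_meas) auto
  have t_K: "distr (machine_transition P m (x m) (a m)) (machine_space P m) (t m) = machine_transition P m (y m) (a m)" for m
  proof (cases "a m")
    case True
    then show ?thesis
      using K(2)[OF x, of m] by (simp add: t_def[abs_def] machine_transition_def distr_id2)
  next
    case False
    have eq: "snd (x m) = snd (y m)" using le by (simp add: less_worn_def)
    have rx: "snd (x m) \<in> space (nonneg_borel \<Otimes>\<^sub>M restrict_space borel (param_set P m))" and
        lx: "0 \<le> level (x m)"
      using machine_in_space[OF x, of m] by (auto simp: machine_space_def space_pair_measure space_restrict_space)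
    have "(\<lambda>z. level (x m) + z) \<in> nonneg_borel \<rightarrow>\<^sub>M nonneg_borel"
      using lx by (intro measurable_into_nonneg_borel borel_measurable_add measurable_const)
        (auto simp: space_restrict_space intro: measurable_restrict_space1)
    then have add: "(\<lambda>z. (level (x m) + z, snd (x m))) \<in> nonneg_borel \<rightarrow>\<^sub>M machine_space P m"
      unfolding machine_space_def by (intro measurable_Pair measurable_const rx)
    have "sets (damage P m (shock_rate (x m)) (shock_param (x m))) = sets nonneg_borel"
      using measurable_space[OF damage_measurable rx] by (simp add: space_prob_algebra split_beta')
    then have "(\<lambda>z. (level (x m) + z, snd (x m))) \<in> damage P m (shock_rate (x m)) (shock_param (x m)) \<rightarrow>\<^sub>M machine_space P m"
      using add measurable_cong_sets by blast
    then show ?thesis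
      using False eq shift[of m]
      by (simp add: t_def[abs_def] machine_transition_def degrade_def distr_distr comp_def algebra_simps)
  qed
  have "transition P y a = PiM UNIV (\<lambda>m. distr (machine_transition P m (x m) (a m)) (machine_space P m) (t m))"
    by (simp add: transition_def t_K)
  also have "\<dots> = distr (transition P x a) (state_space P) (\<lambda>h. \<lambda>m\<in>UNIV. t m (h m))"
    unfolding transition_def state_space_def
    using K[OF x] t_meas
    by (intro distr_PiM_prob_spaces[symmetric]) (auto cong: measurable_cong_sets)
  finally show "transition P y a = distr (transition P x a) (state_space P) T"
    by (simp add: T[abs_def])
qed

text \<open>Under the coupling, the integral from \<open>y\<close> is the integral from
  \<open>x\<close> of \<open>W\<close> composed with \<open>T\<close>, and \<open>T\<close> sends
  every state to a more worn one.\<close>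

lemma nn_integral_transition_mono:
  assumes x: "x \<in> space (state_space P)" and y: "y \<in> space (state_space P)" and le: "less_worn x y"
    and W [measurable]: "W \<in> borel_measurable (state_space P)"
    and mono: "\<And>h h'. h \<in> space (state_space P) \<Longrightarrow> h' \<in> space (state_space P) \<Longrightarrow> less_worn h h' \<Longrightarrow> W h \<le> W h'"
  shows "(\<integral>\<^sup>+h. W h \<partial>transition P x a) \<le> (\<integral>\<^sup>+h. W h \<partial>transition P y a)"
proof -
  define T where "T h m = (if a m then h m else (level (h m) + (level (y m) - level (x m)), snd (h m)))"
    for h :: "'m state" and m
  have T: "transition P y a = distr (transition P x a) (state_space P) T" "T \<in> state_space P \<rightarrow>\<^sub>M state_space P"
    using transition_shift[OF x y le, of a] by (simp_all add: T_def[abs_def])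
  have T': "T \<in> transition P x a \<rightarrow>\<^sub>M state_space P"
    using T(2) measurable_cong_sets[OF sets_transition[OF x] refl] by blast
  have "(\<integral>\<^sup>+h. W h \<partial>transition P x a) \<le> (\<integral>\<^sup>+h. W (T h) \<partial>transition P x a)"
  proof (rule nn_integral_mono)
    fix h assume "h \<in> space (transition P x a)"
    then have h: "h \<in> space (state_space P)" by (simp add: space_transition[OF x])
    have "less_worn h (T h)" using le by (auto simp: less_worn_def T_def)
    then show "W h \<le> W (T h)" using h measurable_space[OF T(2) h] by (intro mono)
  qed
  then show ?thesis unfolding T(1) by (subst nn_integral_distr[OF T']) (simp_all add: W)
qed

lemma admissible_antimono: "less_worn x y \<Longrightarrow> admissible P y \<subseteq> admissible P x"
  by (auto simp: admissible_def failed_def less_worn_def intro: order_trans)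

text \<open>More wear can only turn a preventive replacement into a dearer corrective one.\<close>

lemma stage_cost_mono:
  assumes "less_worn x y"
  shows "stage_cost P x a \<le> stage_cost P y a"
  unfolding stage_cost_def
proof (intro add_left_mono sum_mono)
  fix m
  have "failed P x m \<Longrightarrow> failed P y m"
    using assms by (auto simp: failed_def less_worn_def intro: order_trans)
  then show "cm_cost P m * of_bool (a m \<and> failed P x m) + pm_cost P m * of_bool (a m \<and> \<not> failed P x m)
      \<le> cm_cost P m * of_bool (a m \<and> failed P y m) + pm_cost P m * of_bool (a m \<and> \<not> failed P y m)"
    using pm_less_cm[of m] by auto
qed

text \<open>A more worn state admits fewer actions, and each of them costs at least as much now and
  in expectation later. This comparison passes through every iteration and then to the
  supremum.\<close>

lemma opt_value_mono:
  assumes "x \<in> space (state_space P)" "y \<in> space (state_space P)" "less_worn x y"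
  shows "opt_value x \<le> opt_value y"
proof -
  have "value_iter n x \<le> value_iter n y" for n
    using assms
  proof (induction n arbitrary: x y)
    case (Suc n)
    show ?case
      unfolding value_iter_simps bellman_def
    proof (rule INF_greatest)
      fix a assume "a \<in> admissible P y"
      then have "a \<in> admissible P x" using admissible_antimono[OF Suc.prems(3)] by blast
      moreover have "bellman_cost (value_iter n) x a \<le> bellman_cost (value_iter n) y a"
        unfolding bellman_cost_def using Suc
        by (intro add_mono mult_left_mono ennreal_leI stage_cost_mono nn_integral_transition_mono) auto
      ultimately show "(INF a\<in>admissible P x. bellman_cost (value_iter n) x a) \<le> bellman_cost (value_iter n) y a"
        using INF_lower2[of a "admissible P x" "bellman_cost (value_iter n) x"] by blast
    qed
  qed (simp add: value_iter_simps)
  then show ?thesis unfolding opt_value_def by (intro SUP_mono') 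
qed

subsection \<open>Trajectories and the optimal value\<close>

lemma transition_measurable_pair:
  "(\<lambda>p. transition P (fst p) (snd p)) \<in> step_space P \<rightarrow>\<^sub>M prob_algebra (state_space P)"
  using measurable_pair_count_space[of "transition P", OF transition_measurable]
  by (simp add: step_space_def split_beta')

lemma stage_cost_measurable_pair [measurable]:
  "(\<lambda>p. stage_cost P (fst p) (snd p)) \<in> borel_measurable (step_space P)"
  using measurable_pair_count_space[of "stage_cost P", OF stage_cost_measurable]
  by (simp add: step_space_def split_beta')

lemma space_step_space: "space (step_space P) = space (state_space P) \<times> UNIV"
  by (simp add: step_space_def space_pair_measure)

lemma fst_step_measurable: "fst \<in> step_space P \<rightarrow>\<^sub>M state_space P"
  by (simp add: step_space_def)

lemma Pair_step_measurable: "h \<in> space (state_space P) \<Longrightarrow> (\<lambda>a. (h, a)) \<in> count_space UNIV \<rightarrow>\<^sub>M step_space P"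
  by (simp add: space_step_space)

lemma state_kernel_measurable:
  assumes h0: "h0 \<in> space (state_space P)"
  shows "state_kernel P h0 t \<in> PiM {0..<t} (\<lambda>_. step_space P) \<rightarrow>\<^sub>M prob_algebra (state_space P)"
proof (cases t)
  case 0
  have "return (state_space P) h0 \<in> space (prob_algebra (state_space P))"
    using measurable_space[OF measurable_return_prob_space h0] .
  then show ?thesis
    unfolding state_kernel_def[abs_def] 0 by simp
next
  case (Suc s)
  have "(\<lambda>w. transition P (fst (w s)) (snd (w s))) \<in> PiM {0..<t} (\<lambda>_. step_space P) \<rightarrow>\<^sub>M prob_algebra (state_space P)"
    by (rule measurable_PiM_component_rev[where f = "\<lambda>p. transition P (fst p) (snd p)"])
      (simp_all add: Suc transition_measurable_pair)
  then show ?thesis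
    unfolding state_kernel_def[abs_def] Suc by simp
qed

context
  fixes \<pi> :: "'m policy" and h0 :: "'m state"
  assumes \<pi>: "\<pi> \<in> policies P" and h0: "h0 \<in> space (state_space P)"
begin

lemma policy_measurable:
  "\<pi> t \<in> PiM {0..<t} (\<lambda>_. step_space P) \<Otimes>\<^sub>M state_space P \<rightarrow>\<^sub>M prob_algebra (count_space UNIV)"
  using \<pi> by (simp add: policies_def)

lemma policy_step_measurable:
  "(\<lambda>(w, h). \<pi> t (w, h) \<bind> (\<lambda>a. return (step_space P) (h, a)))
    \<in> PiM {0..<t} (\<lambda>_. step_space P) \<Otimes>\<^sub>M state_space P \<rightarrow>\<^sub>M prob_algebra (step_space P)"
proof -
  have "(\<lambda>z. (snd (fst z), snd z))
      \<in> (PiM {0..<t} (\<lambda>_. step_space P) \<Otimes>\<^sub>M state_space P) \<Otimes>\<^sub>M count_space UNIV \<rightarrow>\<^sub>M step_space P"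
    unfolding step_space_def[of P] by (intro measurable_Pair) auto
  from measurable_compose[OF this measurable_return_prob_space]
  have "(\<lambda>z. \<pi> t z \<bind> (\<lambda>a. return (step_space P) (snd z, a)))
      \<in> PiM {0..<t} (\<lambda>_. step_space P) \<Otimes>\<^sub>M state_space P \<rightarrow>\<^sub>M prob_algebra (step_space P)"
    by (intro measurable_bind_prob_space2[OF policy_measurable]) (simp add: split_beta')
  then show ?thesis by (simp add: split_beta')
qed

lemma step_kernel_measurable:
  "step_kernel P \<pi> h0 t \<in> PiM {0..<t} (\<lambda>_. step_space P) \<rightarrow>\<^sub>M prob_algebra (step_space P)"
  unfolding step_kernel_def[abs_def]
  by (rule measurable_bind_prob_space2[OF state_kernel_measurable[OF h0] policy_step_measurable])

lemma Ionescu_Tulcea_step_kernel: "Ionescu_Tulcea (step_kernel P \<pi> h0) (\<lambda>_. step_space P)"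
proof (rule Ionescu_Tulcea.intro)
  show "step_kernel P \<pi> h0 t \<in> PiM {0..<t} (\<lambda>_. step_space P) \<rightarrow>\<^sub>M subprob_algebra (step_space P)" for t
    by (rule measurable_prob_algebraD[OF step_kernel_measurable])
  show "prob_space (step_kernel P \<pi> h0 t w)" if "w \<in> space (PiM {0..<t} (\<lambda>_. step_space P))" for t w
    using measurable_space[OF step_kernel_measurable that] by (simp add: space_prob_algebra)
qed

interpretation IT: Ionescu_Tulcea "step_kernel P \<pi> h0" "\<lambda>_. step_space P"
  by (rule Ionescu_Tulcea_step_kernel)

lemma trajectory_eq: "trajectory P \<pi> h0 = IT.PF.lim"
  by (simp add: trajectory_def)

section \<open>Disintegration of the trajectory law\<close>

lemma sets_trajectory [measurable_cong]: "sets (trajectory P \<pi> h0) = sets (PiM UNIV (\<lambda>_. step_space P))"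
  by (simp add: trajectory_eq)

lemma space_trajectory: "space (trajectory P \<pi> h0) = space (PiM UNIV (\<lambda>_. step_space P))"
  by (simp add: trajectory_eq)

lemma trajectory_component_measurable [measurable]: "(\<lambda>w. w t) \<in> trajectory P \<pi> h0 \<rightarrow>\<^sub>M step_space P"
  by (subst measurable_cong_sets[OF sets_trajectory refl]) simp

lemma trajectory_restrict_measurable:
  "(\<lambda>w. restrict w {0..<n}) \<in> trajectory P \<pi> h0 \<rightarrow>\<^sub>M PiM {0..<n} (\<lambda>_. step_space P)"
  by (subst measurable_cong_sets[OF sets_trajectory refl]) (rule measurable_restrict_subset, simp)

text \<open>This identifies the law of a finite history with an iterated composition of step
  kernels, which is the only access to the projective limit that the later integrals need.\<close>

lemma distr_trajectory_restrict:
  "distr (trajectory P \<pi> h0) (PiM {0..<n} (\<lambda>_. step_space P)) (\<lambda>w. restrict w {0..<n})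
     = IT.C 0 n (\<lambda>_. undefined)"
proof (rule measure_eqI)
  have u: "(\<lambda>_. undefined) \<in> space (PiM {0..<0::nat} (\<lambda>_. step_space P))"
    by (simp add: space_PiM)
  show "sets (distr (trajectory P \<pi> h0) (PiM {0..<n} (\<lambda>_. step_space P)) (\<lambda>w. restrict w {0..<n}))
      = sets (IT.C 0 n (\<lambda>_. undefined))"
    using IT.sets_C[OF u, of n] by simp
  fix X assume "X \<in> sets (distr (trajectory P \<pi> h0) (PiM {0..<n} (\<lambda>_. step_space P)) (\<lambda>w. restrict w {0..<n}))"
  then have X: "X \<in> sets (PiM {0..<n} (\<lambda>_. step_space P))" by simp
  have "emeasure (distr (trajectory P \<pi> h0) (PiM {0..<n} (\<lambda>_. step_space P)) (\<lambda>w. restrict w {0..<n})) X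
      = emeasure IT.PF.lim (IT.PF.emb UNIV {0..<n} X)"
    by (subst emeasure_distr[OF trajectory_restrict_measurable X])
      (simp add: space_trajectory trajectory_eq prod_emb_def space_PiM)
  also have "\<dots> = emeasure (IT.CI {0..<n}) X"
    using X by (intro IT.lim) auto
  also have "\<dots> = emeasure (IT.C 0 n (\<lambda>_. undefined)) X"
    using X by (simp add: IT.emeasure_CI[of _ n] prod_emb_id sets.sets_into_space[OF X, unfolded space_PiM])
  finally show "emeasure (distr (trajectory P \<pi> h0) (PiM {0..<n} (\<lambda>_. step_space P)) (\<lambda>w. restrict w {0..<n})) X
      = emeasure (IT.C 0 n (\<lambda>_. undefined)) X" .
qed

lemma prob_space_trajectory: "prob_space (trajectory P \<pi> h0)"
proof -
  \<comment> \<open>Even restriction to the empty history preserves total mass, so horizon 0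
    suffices.\<close>
  have "prob_space (IT.C 0 0 (\<lambda>_. undefined))"
    by (rule IT.prob_space_C) (simp add: space_PiM)
  then show ?thesis
    using prob_space_distrD[OF trajectory_restrict_measurable[of 0]] distr_trajectory_restrict[of 0] by simp
qed

text \<open>Conditioning on the history before epoch \<open>t\<close>: the pair at \<open>t\<close>
  is drawn from the step kernel of that history.\<close>

lemma nn_integral_trajectory_step:
  assumes f: "f \<in> borel_measurable (step_space P)"
  shows "(\<integral>\<^sup>+w. f (w t) \<partial>trajectory P \<pi> h0)
    = (\<integral>\<^sup>+w. (\<integral>\<^sup>+p. f p \<partial>step_kernel P \<pi> h0 t (restrict w {0..<t})) \<partial>trajectory P \<pi> h0)"
proof -
  let ?S = "\<lambda>n. PiM {0..<n} (\<lambda>_. step_space P)"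
  have u: "(\<lambda>_. undefined) \<in> space (PiM {0..<0::nat} (\<lambda>_. step_space P))"
    by (simp add: space_PiM)
  have ft: "(\<lambda>v. f (v t)) \<in> borel_measurable (?S (Suc t))"
    by (rule measurable_PiM_component_rev[where f = f]) (simp_all add: f)
  have kernel: "(\<lambda>v. \<integral>\<^sup>+p. f p \<partial>step_kernel P \<pi> h0 t v) \<in> borel_measurable (?S t)"
    by (rule measurable_compose[OF measurable_prob_algebraD[OF step_kernel_measurable]
          nn_integral_measurable_subprob_algebra[OF f]])
  \<comment> \<open>The horizon \<open>Suc t\<close> is the shortest one whose histories contain
    coordinate \<open>t\<close>; its last kernel is then split off.\<close>
  have "(\<integral>\<^sup>+w. f (w t) \<partial>trajectory P \<pi> h0)
      = (\<integral>\<^sup>+v. f (v t) \<partial>distr (trajectory P \<pi> h0) (?S (Suc t)) (\<lambda>w. restrict w {0..<Suc t}))"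
    by (subst nn_integral_distr[OF trajectory_restrict_measurable]) (simp_all add: ft)
  also have "\<dots> = (\<integral>\<^sup>+v. f (v t) \<partial>(IT.C 0 t (\<lambda>_. undefined) \<bind> IT.eP t))"
    by (simp add: distr_trajectory_restrict)
  also have "\<dots> = (\<integral>\<^sup>+v. (\<integral>\<^sup>+v'. f (v' t) \<partial>IT.eP t v) \<partial>IT.C 0 t (\<lambda>_. undefined))"
  proof (rule nn_integral_bind[OF ft])
    have "sets (IT.C 0 t (\<lambda>_. undefined)) = sets (?S t)"
      using IT.sets_C[OF u, of t] by simp
    from measurable_cong_sets[OF this refl]
    show "IT.eP t \<in> IT.C 0 t (\<lambda>_. undefined) \<rightarrow>\<^sub>M subprob_algebra (?S (Suc t))"
      using IT.measurable_eP[of t] by blast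
  qed
  also have "\<dots> = (\<integral>\<^sup>+v. (\<integral>\<^sup>+p. f p \<partial>step_kernel P \<pi> h0 t v) \<partial>IT.C 0 t (\<lambda>_. undefined))"
    by (rule nn_integral_cong) (simp add: IT.space_C[OF u] IT.nn_integral_eP[OF _ ft])
  also have "\<dots> = (\<integral>\<^sup>+w. (\<integral>\<^sup>+p. f p \<partial>step_kernel P \<pi> h0 t (restrict w {0..<t})) \<partial>trajectory P \<pi> h0)"
    unfolding distr_trajectory_restrict[symmetric]
    by (subst nn_integral_distr[OF trajectory_restrict_measurable]) (simp_all add: kernel)
  finally show ?thesis .
qed

lemma nn_integral_step_kernel:
  assumes f: "f \<in> borel_measurable (step_space P)" and v: "v \<in> space (PiM {0..<t} (\<lambda>_. step_space P))"
  shows "(\<integral>\<^sup>+p. f p \<partial>step_kernel P \<pi> h0 t v)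
    = (\<integral>\<^sup>+h. (\<integral>\<^sup>+a. f (h, a) \<partial>\<pi> t (v, h)) \<partial>state_kernel P h0 t v)"
proof -
  have sk: "sets (state_kernel P h0 t v) = sets (state_space P)"
    using measurable_space[OF state_kernel_measurable[OF h0] v] by (simp add: space_prob_algebra)
  have "(\<lambda>h. \<pi> t (v, h) \<bind> (\<lambda>a. return (step_space P) (h, a))) \<in> state_space P \<rightarrow>\<^sub>M prob_algebra (step_space P)"
    using measurable_compose[OF measurable_Pair1'[OF v] policy_step_measurable] by simp
  from measurable_prob_algebraD[OF this]
  have "(\<lambda>h. \<pi> t (v, h) \<bind> (\<lambda>a. return (step_space P) (h, a)))
      \<in> state_kernel P h0 t v \<rightarrow>\<^sub>M subprob_algebra (step_space P)"
    using measurable_cong_sets[OF sk refl] by blast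
  then have "(\<integral>\<^sup>+p. f p \<partial>step_kernel P \<pi> h0 t v)
      = (\<integral>\<^sup>+h. (\<integral>\<^sup>+p. f p \<partial>(\<pi> t (v, h) \<bind> (\<lambda>a. return (step_space P) (h, a)))) \<partial>state_kernel P h0 t v)"
    unfolding step_kernel_def by (rule nn_integral_bind[OF f])
  also have "\<dots> = (\<integral>\<^sup>+h. (\<integral>\<^sup>+a. f (h, a) \<partial>\<pi> t (v, h)) \<partial>state_kernel P h0 t v)"
  proof (rule nn_integral_cong)
    fix h assume "h \<in> space (state_kernel P h0 t v)"
    then have h: "h \<in> space (state_space P)" using sets_eq_imp_space_eq[OF sk] by simp
    have s\<pi>: "sets (\<pi> t (v, h)) = sets (count_space UNIV)"
      using measurable_space[OF policy_measurable[of t], of "(v, h)"] v h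
      by (simp add: space_prob_algebra space_pair_measure)
    have "(\<lambda>a. return (step_space P) (h, a)) \<in> count_space UNIV \<rightarrow>\<^sub>M subprob_algebra (step_space P)"
      by (rule measurable_compose[OF Pair_step_measurable[OF h] return_measurable])
    then have "(\<lambda>a. return (step_space P) (h, a)) \<in> \<pi> t (v, h) \<rightarrow>\<^sub>M subprob_algebra (step_space P)"
      using measurable_cong_sets[OF s\<pi> refl] by blast
    then have "(\<integral>\<^sup>+p. f p \<partial>(\<pi> t (v, h) \<bind> (\<lambda>a. return (step_space P) (h, a))))
        = (\<integral>\<^sup>+a. (\<integral>\<^sup>+p. f p \<partial>return (step_space P) (h, a)) \<partial>\<pi> t (v, h))"
      by (rule nn_integral_bind[OF f])
    also have "\<dots> = (\<integral>\<^sup>+a. f (h, a) \<partial>\<pi> t (v, h))"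
      by (intro nn_integral_cong nn_integral_return f) (simp add: space_step_space h)
    finally show "(\<integral>\<^sup>+p. f p \<partial>(\<pi> t (v, h) \<bind> (\<lambda>a. return (step_space P) (h, a)))) = (\<integral>\<^sup>+a. f (h, a) \<partial>\<pi> t (v, h))" .
  qed
  finally show ?thesis .
qed

text \<open>This carries a property of the chosen actions from the policy to the trajectory. It
  serves admissibility for arbitrary policies and optimality for the greedy one.\<close>

lemma AE_trajectory_policy:
  assumes R: "Measurable.pred (step_space P) (\<lambda>p. R (fst p) (snd p))"
    and AE: "\<And>v h. v \<in> space (PiM {0..<t} (\<lambda>_. step_space P)) \<Longrightarrow> h \<in> space (state_space P) \<Longrightarrow>
      AE a in \<pi> t (v, h). R h a"
  shows "AE w in trajectory P \<pi> h0. R (fst (w t)) (snd (w t))"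
proof -
  \<comment> \<open>As the indicator of a violation, \<open>f\<close> turns the almost-sure claim
    into a vanishing integral, to which the disintegration applies.\<close>
  define f where "f p = (if R (fst p) (snd p) then 0 else 1 :: ennreal)" for p
  have f [measurable]: "f \<in> borel_measurable (step_space P)"
    unfolding f_def[abs_def] using R by measurable
  have "(\<integral>\<^sup>+p. f p \<partial>step_kernel P \<pi> h0 t v) = 0" if v: "v \<in> space (PiM {0..<t} (\<lambda>_. step_space P))" for v
  proof -
    have sk: "space (state_kernel P h0 t v) = space (state_space P)"
      using measurable_space[OF state_kernel_measurable[OF h0] v]
      by (auto simp: space_prob_algebra dest: sets_eq_imp_space_eq)
    have "(\<integral>\<^sup>+a. f (h, a) \<partial>\<pi> t (v, h)) = 0" if h: "h \<in> space (state_space P)" for h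
    proof -
      have "(\<integral>\<^sup>+a. f (h, a) \<partial>\<pi> t (v, h)) = (\<integral>\<^sup>+a. 0 \<partial>\<pi> t (v, h))"
        by (rule nn_integral_cong_AE) (use AE[OF v h] in \<open>auto simp: f_def\<close>)
      then show ?thesis by simp
    qed
    then have "(\<integral>\<^sup>+p. f p \<partial>step_kernel P \<pi> h0 t v) = (\<integral>\<^sup>+h. 0 \<partial>state_kernel P h0 t v)"
      unfolding nn_integral_step_kernel[OF f v] by (intro nn_integral_cong) (simp add: sk)
    then show ?thesis by simp
  qed
  then have "(\<integral>\<^sup>+w. f (w t) \<partial>trajectory P \<pi> h0) = 0"
    using measurable_space[OF trajectory_restrict_measurable[of t]]
    by (simp add: nn_integral_trajectory_step[OF f] cong: nn_integral_cong)
  then have "AE w in trajectory P \<pi> h0. f (w t) = 0"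
    by (subst (asm) nn_integral_0_iff_AE) simp_all
  then show ?thesis by (rule AE_mp) (simp add: f_def)
qed

text \<open>For a function of the state alone the action integrates out, because the policy returns
  a probability measure.\<close>

lemma nn_integral_trajectory_state:
  assumes g: "g \<in> borel_measurable (state_space P)"
  shows "(\<integral>\<^sup>+w. g (fst (w t)) \<partial>trajectory P \<pi> h0)
    = (\<integral>\<^sup>+w. (\<integral>\<^sup>+h. g h \<partial>state_kernel P h0 t (restrict w {0..<t})) \<partial>trajectory P \<pi> h0)"
proof -
  have f: "(\<lambda>p. g (fst p)) \<in> borel_measurable (step_space P)"
    by (rule measurable_compose[OF fst_step_measurable g])
  have "(\<integral>\<^sup>+p. g (fst p) \<partial>step_kernel P \<pi> h0 t v) = (\<integral>\<^sup>+h. g h \<partial>state_kernel P h0 t v)"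
    if v: "v \<in> space (PiM {0..<t} (\<lambda>_. step_space P))" for v
    unfolding nn_integral_step_kernel[OF f v]
  proof (rule nn_integral_cong)
    fix h assume "h \<in> space (state_kernel P h0 t v)"
    then have "h \<in> space (state_space P)"
      using measurable_space[OF state_kernel_measurable[OF h0] v]
      by (auto simp: space_prob_algebra dest: sets_eq_imp_space_eq)
    then have "prob_space (\<pi> t (v, h))"
      using measurable_space[OF policy_measurable[of t], of "(v, h)"] v
      by (simp add: space_prob_algebra space_pair_measure)
    then show "(\<integral>\<^sup>+a. g (fst (h, a)) \<partial>\<pi> t (v, h)) = g h"
      by (simp add: prob_space.emeasure_space_1)
  qed
  then show ?thesis
    using measurable_space[OF trajectory_restrict_measurable[of t]]
    by (simp add: nn_integral_trajectory_step[OF f] cong: nn_integral_cong)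
qed

lemma nn_integral_trajectory_initial:
  assumes g: "g \<in> borel_measurable (state_space P)"
  shows "(\<integral>\<^sup>+w. g (fst (w 0)) \<partial>trajectory P \<pi> h0) = g h0"
  unfolding nn_integral_trajectory_state[OF g]
  by (simp add: state_kernel_def nn_integral_return[OF h0 g] prob_space.emeasure_space_1[OF prob_space_trajectory])

lemma nn_integral_trajectory_Suc:
  assumes g: "g \<in> borel_measurable (state_space P)"
  shows "(\<integral>\<^sup>+w. g (fst (w (Suc t))) \<partial>trajectory P \<pi> h0)
    = (\<integral>\<^sup>+w. (\<integral>\<^sup>+h. g h \<partial>transition P (fst (w t)) (snd (w t))) \<partial>trajectory P \<pi> h0)"
  \<comment> \<open>The history up to \<open>Suc t\<close> keeps coordinate \<open>t\<close>, the
    only one that \<open>state_kernel\<close> reads at epoch \<open>Suc t\<close>.\<close>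
  unfolding nn_integral_trajectory_state[OF g] by (simp add: state_kernel_def)

section \<open>Telescoping of discounted costs along a trajectory\<close>

definition expected_stage_cost :: "nat \<Rightarrow> ennreal" where
  "expected_stage_cost t = (\<integral>\<^sup>+w. ennreal (stage_cost P (fst (w t)) (snd (w t))) \<partial>trajectory P \<pi> h0)"

definition expected_value :: "nat \<Rightarrow> ennreal" where
  "expected_value t = (\<integral>\<^sup>+w. opt_value (fst (w t)) \<partial>trajectory P \<pi> h0)"

lemma expected_value_0: "expected_value 0 = opt_value h0"
  unfolding expected_value_def by (rule nn_integral_trajectory_initial[OF opt_value_measurable])

lemma state_in_space: "w \<in> space (trajectory P \<pi> h0) \<Longrightarrow> fst (w t) \<in> space (state_space P)"
  using measurable_space[OF trajectory_component_measurable, of w t] by (auto simp: space_step_space)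

lemma expected_bellman_cost:
  "(\<integral>\<^sup>+w. bellman_cost opt_value (fst (w t)) (snd (w t)) \<partial>trajectory P \<pi> h0)
     = expected_stage_cost t + ennreal (discount P) * expected_value (Suc t)"
proof -
  have "(\<lambda>p. \<integral>\<^sup>+h. opt_value h \<partial>transition P (fst p) (snd p)) \<in> borel_measurable (step_space P)"
    by (rule measurable_compose[OF measurable_prob_algebraD[OF transition_measurable_pair]
          nn_integral_measurable_subprob_algebra[OF opt_value_measurable]])
  from measurable_compose[OF trajectory_component_measurable this]
  have [measurable]: "(\<lambda>w. \<integral>\<^sup>+h. opt_value h \<partial>transition P (fst (w t)) (snd (w t)))
      \<in> borel_measurable (trajectory P \<pi> h0)" .
  have [measurable]: "(\<lambda>w. stage_cost P (fst (w t)) (snd (w t))) \<in> borel_measurable (trajectory P \<pi> h0)"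
    by (rule measurable_compose[OF trajectory_component_measurable stage_cost_measurable_pair])
  show ?thesis
    unfolding bellman_cost_def expected_stage_cost_def expected_value_def
      nn_integral_trajectory_Suc[OF opt_value_measurable]
    by (simp add: nn_integral_add nn_integral_cmult)
qed

lemma expected_value_le:
  "expected_value t \<le> expected_stage_cost t + ennreal (discount P) * expected_value (Suc t)"
proof -
  have "(\<lambda>(h, a). a \<in> admissible P h) \<in> state_space P \<Otimes>\<^sub>M count_space UNIV \<rightarrow>\<^sub>M count_space UNIV"
    by (rule measurable_pair_count_space[OF admissible_measurable])
  then have "Measurable.pred (step_space P) (\<lambda>p. snd p \<in> admissible P (fst p))"
    by (simp add: step_space_def split_beta')
  moreover have "AE a in \<pi> t (v, h). a \<in> admissible P h"
    if "v \<in> space (PiM {0..<t} (\<lambda>_. step_space P))" "h \<in> space (state_space P)" for v h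
    using \<pi> that by (auto simp: policies_def)
  ultimately have "AE w in trajectory P \<pi> h0. snd (w t) \<in> admissible P (fst (w t))"
    by (intro AE_trajectory_policy[where R = "\<lambda>h a. a \<in> admissible P h"])
  then have "AE w in trajectory P \<pi> h0. opt_value (fst (w t)) \<le> bellman_cost opt_value (fst (w t)) (snd (w t))"
    by (rule AE_mp) (auto intro!: opt_value_le_bellman_cost state_in_space)
  then show ?thesis
    unfolding expected_bellman_cost[symmetric] unfolding expected_value_def by (rule nn_integral_mono_AE)
qed

text \<open>Each step spends the discounted remainder on one more stage cost and a new remainder.
  The remainder stays a summand, since subtraction in \<open>ennreal\<close> does not cancel
  freely.\<close>

lemma opt_value_le_finite_horizon:
  "opt_value h0 \<le> (\<Sum>t<n. ennreal (discount P ^ t) * expected_stage_cost t) + ennreal (discount P ^ n) * expected_value n"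
proof (induction n)
  case (Suc n)
  have "ennreal (discount P ^ n) * expected_value n
      \<le> ennreal (discount P ^ n) * (expected_stage_cost n + ennreal (discount P) * expected_value (Suc n))"
    by (intro mult_left_mono expected_value_le) simp
  also have "\<dots> = ennreal (discount P ^ n) * expected_stage_cost n
      + ennreal (discount P ^ Suc n) * expected_value (Suc n)"
    using discount_nonneg by (simp add: distrib_left ennreal_mult mult_ac)
  finally have "(\<Sum>t<n. ennreal (discount P ^ t) * expected_stage_cost t) + ennreal (discount P ^ n) * expected_value n
      \<le> (\<Sum>t<Suc n. ennreal (discount P ^ t) * expected_stage_cost t) + ennreal (discount P ^ Suc n) * expected_value (Suc n)"
    by (simp add: add.assoc add_left_mono del: power_Suc)
  with Suc show ?case by (rule order_trans)
qed (simp add: expected_value_0)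

lemma finite_horizon_le_opt_value:
  assumes greedy: "\<And>t. AE w in trajectory P \<pi> h0. bellman_cost opt_value (fst (w t)) (snd (w t)) \<le> opt_value (fst (w t))"
  shows "(\<Sum>t<n. ennreal (discount P ^ t) * expected_stage_cost t) + ennreal (discount P ^ n) * expected_value n \<le> opt_value h0"
proof (induction n)
  case (Suc n)
  have "expected_stage_cost n + ennreal (discount P) * expected_value (Suc n) \<le> expected_value n"
    unfolding expected_bellman_cost[symmetric] unfolding expected_value_def
    by (rule nn_integral_mono_AE[OF greedy])
  then have "ennreal (discount P ^ n) * (expected_stage_cost n + ennreal (discount P) * expected_value (Suc n))
      \<le> ennreal (discount P ^ n) * expected_value n"
    by (intro mult_left_mono) simp_all
  moreover have "ennreal (discount P ^ n) * (expected_stage_cost n + ennreal (discount P) * expected_value (Suc n))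
      = ennreal (discount P ^ n) * expected_stage_cost n + ennreal (discount P ^ Suc n) * expected_value (Suc n)"
    using discount_nonneg by (simp add: distrib_left ennreal_mult mult_ac)
  ultimately have "(\<Sum>t<Suc n. ennreal (discount P ^ t) * expected_stage_cost t) + ennreal (discount P ^ Suc n) * expected_value (Suc n)
      \<le> (\<Sum>t<n. ennreal (discount P ^ t) * expected_stage_cost t) + ennreal (discount P ^ n) * expected_value n"
    by (simp add: add.assoc add_left_mono del: power_Suc)
  then show ?case using Suc by (rule order_trans)
qed (simp add: expected_value_0)

definition total_cost :: ennreal where
  "total_cost = (\<Sum>t. ennreal (discount P ^ t) * expected_stage_cost t)"

lemma summable_discounted: "summable (\<lambda>t. discount P ^ t * stage_cost P (fst (w t)) (snd (w t)))"
proof (rule summable_comparison_test')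
  show "summable (\<lambda>t. discount P ^ t * cost_bound)"
    using discount_nonneg discount_less_1 by (intro summable_mult2 summable_geometric) simp
  show "norm (discount P ^ t * stage_cost P (fst (w t)) (snd (w t))) \<le> discount P ^ t * cost_bound" for t
    using discount_nonneg stage_cost_nonneg stage_cost_le by (simp add: abs_mult mult_left_mono)
qed

lemma total_cost_less_top: "total_cost < top"
proof -
  interpret prob_space "trajectory P \<pi> h0" by (rule prob_space_trajectory)
  have "expected_stage_cost t \<le> ennreal cost_bound" for t
  proof -
    have "expected_stage_cost t \<le> (\<integral>\<^sup>+w. ennreal cost_bound \<partial>trajectory P \<pi> h0)"
      unfolding expected_stage_cost_def by (intro nn_integral_mono ennreal_leI stage_cost_le)
    then show ?thesis by (simp add: emeasure_space_1)
  qed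
  then have "total_cost \<le> (\<Sum>t. ennreal (discount P ^ t * cost_bound))"
    unfolding total_cost_def using discount_nonneg cost_bound_nonneg
    by (intro suminf_le) (auto simp: ennreal_mult intro: mult_left_mono)
  also have "\<dots> = ennreal (\<Sum>t. discount P ^ t * cost_bound)"
    using discount_nonneg discount_less_1 cost_bound_nonneg
    by (intro suminf_ennreal2 summable_mult2 summable_geometric) auto
  also have "\<dots> < top" by simp
  finally show ?thesis .
qed

text \<open>Nonnegativity of the stage costs permits exchanging sum and expectation. The geometric
  bound makes every pathwise real series converge, so it agrees with its extended
  counterpart.\<close>

lemma policy_cost_eq_total_cost: "policy_cost P \<pi> h0 = enn2real total_cost"
proof -
  have [measurable]: "(\<lambda>w. stage_cost P (fst (w t)) (snd (w t))) \<in> borel_measurable (trajectory P \<pi> h0)" for t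
    by (rule measurable_compose[OF trajectory_component_measurable stage_cost_measurable_pair])
  have "(\<integral>\<^sup>+w. ennreal (\<Sum>t. discount P ^ t * stage_cost P (fst (w t)) (snd (w t))) \<partial>trajectory P \<pi> h0)
      = (\<integral>\<^sup>+w. (\<Sum>t. ennreal (discount P ^ t) * ennreal (stage_cost P (fst (w t)) (snd (w t)))) \<partial>trajectory P \<pi> h0)"
    using discount_nonneg stage_cost_nonneg
    by (intro nn_integral_cong) (simp add: suminf_ennreal2[OF _ summable_discounted, symmetric] ennreal_mult)
  also have "\<dots> = total_cost"
    unfolding total_cost_def expected_stage_cost_def
    by (simp add: nn_integral_suminf nn_integral_cmult)
  finally have "(\<integral>\<^sup>+w. ennreal (\<Sum>t. discount P ^ t * stage_cost P (fst (w t)) (snd (w t))) \<partial>trajectory P \<pi> h0)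
      = total_cost" .
  moreover have "0 \<le> (\<Sum>t. discount P ^ t * stage_cost P (fst (w t)) (snd (w t)))" for w
    using discount_nonneg stage_cost_nonneg by (intro suminf_nonneg summable_discounted) simp
  ultimately show ?thesis
    unfolding policy_cost_def by (subst integral_eq_nn_integral) auto
qed

text \<open>The uniform bound \<open>?B\<close> on \<open>opt_value\<close> forces the discounted
  remainder of the finite-horizon estimate to vanish.\<close>

lemma opt_value_le_total_cost: "opt_value h0 \<le> total_cost"
proof -
  interpret prob_space "trajectory P \<pi> h0" by (rule prob_space_trajectory)
  let ?B = "cost_bound / (1 - discount P)"
  have B: "0 \<le> ?B" using cost_bound_nonneg discount_less_1 by simp
  have "expected_value n \<le> ennreal ?B" for n
  proof -
    have "expected_value n \<le> (\<integral>\<^sup>+w. ennreal ?B \<partial>trajectory P \<pi> h0)"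
      unfolding expected_value_def by (intro nn_integral_mono opt_value_le state_in_space)
    then show ?thesis by (simp add: emeasure_space_1)
  qed
  then have "ennreal (discount P ^ n) * expected_value n \<le> ennreal (discount P ^ n * ?B)" for n
    unfolding ennreal_mult[OF zero_le_power[OF discount_nonneg] B] by (rule mult_left_mono) simp
  then have "opt_value h0 \<le> total_cost + ennreal (discount P ^ n * ?B)" for n
    unfolding total_cost_def
    by (intro order_trans[OF opt_value_le_finite_horizon[of n] add_mono] sum_le_suminf summableI) auto
  moreover have "(\<lambda>n. total_cost + ennreal (discount P ^ n * ?B)) \<longlonglongrightarrow> total_cost + ennreal (0 * ?B)"
    using discount_nonneg discount_less_1
    by (intro tendsto_add tendsto_const tendsto_ennrealI tendsto_mult LIMSEQ_realpow_zero)
  ultimately show ?thesis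
    by (intro LIMSEQ_le_const[where X = "\<lambda>n. total_cost + ennreal (discount P ^ n * ?B)"]) auto
qed

lemma opt_value_le_policy_cost: "enn2real (opt_value h0) \<le> policy_cost P \<pi> h0"
  unfolding policy_cost_eq_total_cost using opt_value_le_total_cost total_cost_less_top by (rule enn2real_mono)

text \<open>Here the remainder is simply dropped, being nonnegative; the partial sums of the costs
  then stay below \<open>opt_value h0\<close>.\<close>

lemma policy_cost_greedy:
  assumes "\<And>t. AE w in trajectory P \<pi> h0. bellman_cost opt_value (fst (w t)) (snd (w t)) \<le> opt_value (fst (w t))"
  shows "policy_cost P \<pi> h0 = enn2real (opt_value h0)"
proof -
  have "(\<Sum>t<n. ennreal (discount P ^ t) * expected_stage_cost t) \<le> opt_value h0" for n
    using finite_horizon_le_opt_value[OF assms, of n] by (rule order_trans[rotated]) simp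
  then have "total_cost \<le> opt_value h0"
    unfolding total_cost_def by (intro suminf_le_const summableI)
  with opt_value_le_total_cost show ?thesis by (simp add: policy_cost_eq_total_cost)
qed

end

section \<open>A measurable greedy policy attains the optimal value\<close>

lemma greedy_pred_measurable:
  "Measurable.pred (state_space P) (\<lambda>h. bellman_cost opt_value h a \<le> opt_value h)"
  unfolding pred_def
  by (intro borel_measurable_le bellman_cost_measurable opt_value_measurable)

text \<open>Ties are broken by the least code in an enumeration of the actions, which makes the
  selector measurable; an arbitrary choice need not be.\<close>

definition greedy :: "'m state \<Rightarrow> 'm action" where
  "greedy h = from_nat (LEAST n. from_nat n \<in> admissible P h \<and>
     bellman_cost opt_value h (from_nat n) \<le> opt_value h)"

lemma
  assumes "h \<in> space (state_space P)"
  shows greedy_admissible: "greedy h \<in> admissible P h"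
    and greedy_bellman_cost: "bellman_cost opt_value h (greedy h) \<le> opt_value h"
proof -
  obtain a where "a \<in> admissible P h" "bellman_cost opt_value h a \<le> opt_value h"
    using ex_greedy_action[OF assms] by blast
  then have "from_nat (to_nat a) \<in> admissible P h \<and> bellman_cost opt_value h (from_nat (to_nat a)) \<le> opt_value h"
    by simp
  then have "greedy h \<in> admissible P h \<and> bellman_cost opt_value h (greedy h) \<le> opt_value h"
    unfolding greedy_def by (rule LeastI)
  then show "greedy h \<in> admissible P h" "bellman_cost opt_value h (greedy h) \<le> opt_value h"
    by auto
qed

lemma greedy_measurable: "greedy \<in> state_space P \<rightarrow>\<^sub>M count_space UNIV"
proof -
  have "(\<lambda>h. LEAST n. from_nat n \<in> admissible P h \<and> bellman_cost opt_value h (from_nat n) \<le> opt_value h)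
      \<in> state_space P \<rightarrow>\<^sub>M count_space UNIV"
    by (intro measurable_Least pred_intros_logic admissible_measurable greedy_pred_measurable)
  from measurable_compose[OF this, of from_nat "count_space UNIV"] show ?thesis
    by (simp add: greedy_def[abs_def])
qed

definition greedy_policy :: "'m policy" where
  "greedy_policy t = (\<lambda>z. return (count_space UNIV) (greedy (snd z)))"

lemma greedy_policy: "greedy_policy \<in> policies P"
  unfolding policies_def
proof (intro CollectI allI conjI ballI)
  fix t :: nat
  show "greedy_policy t \<in> PiM {0..<t} (\<lambda>_. step_space P) \<Otimes>\<^sub>M state_space P \<rightarrow>\<^sub>M prob_algebra (count_space UNIV)"
    unfolding greedy_policy_def
    by (intro measurable_compose[OF _ measurable_return_prob_space] measurable_compose[OF measurable_snd greedy_measurable])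
  show "AE a in greedy_policy t (w, h). a \<in> admissible P h" if "h \<in> space (state_space P)" for h and w :: "nat \<Rightarrow> 'm state \<times> 'm action"
    using greedy_admissible[OF that] unfolding greedy_policy_def by (subst AE_return) simp_all
qed

lemma V_eq_opt_value:
  assumes h: "h \<in> space (state_space P)"
  shows "V P h = enn2real (opt_value h)"
  unfolding V_def
proof (rule cInf_eq_minimum)
  have "AE w in trajectory P greedy_policy h. bellman_cost opt_value (fst (w t)) (snd (w t)) \<le> opt_value (fst (w t))" for t
  proof (rule AE_trajectory_policy[OF greedy_policy h])
    have "(\<lambda>(h, a). bellman_cost opt_value h a \<le> opt_value h) \<in> state_space P \<Otimes>\<^sub>M count_space UNIV \<rightarrow>\<^sub>M count_space UNIV"
      by (rule measurable_pair_count_space[OF greedy_pred_measurable])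
    then show "Measurable.pred (step_space P) (\<lambda>p. bellman_cost opt_value (fst p) (snd p) \<le> opt_value (fst p))"
      by (simp add: step_space_def split_beta')
    show "AE a in greedy_policy t (v, h). bellman_cost opt_value h a \<le> opt_value h"
      if "h \<in> space (state_space P)" for v h
      using greedy_bellman_cost[OF that] unfolding greedy_policy_def by (subst AE_return) simp_all
  qed
  then have "policy_cost P greedy_policy h = enn2real (opt_value h)"
    by (rule policy_cost_greedy[OF greedy_policy h])
  then show "enn2real (opt_value h) \<in> (\<lambda>\<pi>. policy_cost P \<pi> h) ` policies P"
    by (intro image_eqI[OF _ greedy_policy]) simp
qed (use opt_value_le_policy_cost[OF _ h] in auto)

section \<open>Expectations of the optimal value\<close>

lemma V_nonneg: "h \<in> space (state_space P) \<Longrightarrow> 0 \<le> V P h"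
  by (simp add: V_eq_opt_value)

lemma V_measurable: "V P \<in> borel_measurable (state_space P)"
proof -
  have "(\<lambda>h. enn2real (opt_value h)) \<in> borel_measurable (state_space P)" by measurable
  then show ?thesis by (rule measurable_cong[THEN iffD1, rotated]) (simp add: V_eq_opt_value)
qed

lemma integral_V:
  assumes h: "h \<in> space (state_space P)"
  shows "(LINT h'|transition P h a. V P h') = enn2real (\<integral>\<^sup>+h'. opt_value h' \<partial>transition P h a)"
proof -
  have "V P \<in> borel_measurable (transition P h a)"
    using V_measurable measurable_cong_sets[OF sets_transition[OF h] refl] by blast
  moreover have "AE h' in transition P h a. 0 \<le> V P h'"
    by (rule AE_I2) (simp add: V_nonneg space_transition[OF h])
  ultimately have "(LINT h'|transition P h a. V P h') = enn2real (\<integral>\<^sup>+h'. ennreal (V P h') \<partial>transition P h a)"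
    by (rule integral_eq_nn_integral)
  also have "(\<integral>\<^sup>+h'. ennreal (V P h') \<partial>transition P h a) = (\<integral>\<^sup>+h'. opt_value h' \<partial>transition P h a)"
  proof (rule nn_integral_cong)
    fix h' assume "h' \<in> space (transition P h a)"
    then have h': "h' \<in> space (state_space P)" by (simp add: space_transition[OF h])
    show "ennreal (V P h') = opt_value h'"
      unfolding V_eq_opt_value[OF h'] using opt_value_le[OF h']
      \<comment> \<open>The uniform bound excludes \<open>top\<close>, the one value that the
        passage to real numbers would destroy.\<close>
      by (intro ennreal_enn2real) (metis ennreal_less_top order_le_less_trans)
  qed
  finally show ?thesis .
qed

lemma integral_V_mono:
  assumes x: "x \<in> space (state_space P)" and y: "y \<in> space (state_space P)" and le: "less_worn x y"
  shows "(LINT h|transition P x a. V P h) \<le> (LINT h|transition P y a. V P h)"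
  unfolding integral_V[OF x] integral_V[OF y]
proof (rule enn2real_mono)
  show "(\<integral>\<^sup>+h. opt_value h \<partial>transition P x a) \<le> (\<integral>\<^sup>+h. opt_value h \<partial>transition P y a)"
    using x y le opt_value_measurable opt_value_mono by (rule nn_integral_transition_mono)
  \<comment> \<open>Finiteness of the larger integral is essential: \<open>enn2real\<close> sends
    \<open>top\<close> to 0 and would reverse the inequality.\<close>
  interpret prob_space "transition P y a" by (rule prob_space_transition[OF y])
  have "(\<integral>\<^sup>+h. opt_value h \<partial>transition P y a) \<le> (\<integral>\<^sup>+h. ennreal (cost_bound / (1 - discount P)) \<partial>transition P y a)"
    by (intro nn_integral_mono opt_value_le) (simp add: space_transition[OF y])
  also have "\<dots> < top" by (simp add: emeasure_space_1)
  finally show "(\<integral>\<^sup>+h. opt_value h \<partial>transition P y a) < top" .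
qed

end

theorem theorem1:
  fixes P :: "'m::finite maintenance_model"
    and x y :: "'m state"
    and a :: "'m action"
  assumes "maintenance_mdp P"
    and "x \<in> space (state_space P)"
    and "y \<in> space (state_space P)"
    and "optimal_action P x a"
    and "\<And>m. shock_rate (y m) = shock_rate (x m)"
    and "\<And>m. shock_param (y m) = shock_param (x m)"
    and "\<And>m. a m \<Longrightarrow> level (y m) \<ge> level (x m)"
    and "\<And>m. \<not> a m \<Longrightarrow> level (y m) = level (x m)"
  shows "optimal_action P y a"
proof -
  interpret maintenance_mdp P by fact
  have snd_eq: "snd (x m) = snd (y m)" for m
    using assms(5,6)[of m] by (simp add: prod_eq_iff)
  have le: "less_worn x y"
    unfolding less_worn_def using snd_eq assms(7,8) by (metis order_refl)
  have opt: "a \<in> admissible P x" "\<And>b. b \<in> admissible P x \<Longrightarrow> Q P x a \<le> Q P x b"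
    using assms(4) by (auto simp: optimal_action_def is_arg_min_def not_less)
  have "a \<in> admissible P y"
    unfolding admissible_def
  proof (intro CollectI allI impI)
    fix m assume "failed P y m"
    \<comment> \<open>A machine left alone by \<open>a\<close> has the same level in both states, so
      its failure in \<open>y\<close> would be a failure in \<open>x\<close>, where \<open>a\<close>
      is admissible.\<close>
    then show "a m"
      using opt(1) assms(8)[of m] by (cases "a m") (auto simp: admissible_def failed_def)
  qed
  moreover have "Q P y a \<le> Q P y b" if b: "b \<in> admissible P y" for b
  proof -
    \<comment> \<open>The surcharge of corrective over preventive replacement, summed over the newly
      failed machines. It does not involve the action and so cancels between \<open>a\<close> and
      \<open>b\<close>.\<close>
    define D where "D = (\<Sum>m\<in>UNIV. (cm_cost P m - pm_cost P m) * of_bool (failed P y m \<and> \<not> failed P x m))"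
    have cost: "stage_cost P y c = stage_cost P x c + D" if "\<And>m. failed P y m \<Longrightarrow> c m" for c
    proof -
      have "cm_cost P m * of_bool (c m \<and> failed P y m) + pm_cost P m * of_bool (c m \<and> \<not> failed P y m)
          = (cm_cost P m * of_bool (c m \<and> failed P x m) + pm_cost P m * of_bool (c m \<and> \<not> failed P x m))
            + (cm_cost P m - pm_cost P m) * of_bool (failed P y m \<and> \<not> failed P x m)" for m
      proof -
        have "failed P x m \<Longrightarrow> failed P y m"
          using le by (auto simp: failed_def less_worn_def intro: order_trans)
        with that[of m] show ?thesis
          by (cases "failed P x m"; cases "failed P y m"; cases "c m") simp_all
      qed
      then show ?thesis by (simp add: stage_cost_def D_def sum.distrib)
    qed
    have "transition P y a = transition P x a"
    proof -
      have "machine_transition P m (y m) (a m) = machine_transition P m (x m) (a m)" for m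
      proof (cases "a m")
        case False
        then have "y m = x m" using assms(8) snd_eq by (metis prod_eq_iff)
        then show ?thesis by simp
      qed (simp add: machine_transition_def)
      then show ?thesis by (simp add: transition_def)
    qed
    then have "Q P y a = Q P x a + D"
      using \<open>a \<in> admissible P y\<close> by (simp add: Q_def cost admissible_def)
    \<comment> \<open>Any \<open>b\<close> admissible in the more worn state is also admissible in
      \<open>x\<close>, so it competes with \<open>a\<close> there.\<close>
    also have "\<dots> \<le> Q P x b + D"
      using opt(2) admissible_antimono[OF le] b by auto
    also have "\<dots> \<le> Q P y b"
      using b integral_V_mono[OF assms(2,3) le, of b] discount_nonneg
      by (simp add: Q_def cost admissible_def mult_left_mono)
    finally show ?thesis .
  qed
  ultimately show ?thesis
    by (auto simp: optimal_action_def is_arg_min_def not_less)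
qed

end
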